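(* Let $\Bbbk$ be a field of characteristic zero, $n\in\mathbb N$, and $\varphi_n\colon\mathcal F_n\mathcal O\to\Bbbk$ a Lie algebra homomorphism. If $n=0$, the universal Whittaker module $M_{\varphi_0}$ is irreducible if and only if $\varphi_0(\mathcal U_2)\neq4\varphi_0(\mathcal U_0)$. If $n\ge1$, $M_{\varphi_n}$ is irreducible if and only if $\varphi_n(\mathcal U_{2n+1})\neq4\varphi_n(\mathcal U_{2n-1})$ or $\varphi_n(\mathcal U_{2n+2})\neq4\varphi_n(\mathcal U_{2n})$.
   Context: $\mathcal O$ is the Lie algebra with basis $\{\mathcal U_n\mid n\ge-1\}$ and bracket $[\mathcal U_n,\mathcal U_m]=(n-m)(\mathcal U_{n+m+2}-4\mathcal U_{n+m})$ (where $\mathcal U_{-2},\mathcal U_{-3}$ are interpreted as $0$); concretely $\mathcal U_n=-(t+t^{-1})^{n+1}(t^2-1)\partial$ inside the Witt algebra $\Bbbk[t,t^{-1}]\partial$, and $\mathcal O$ is the span of $L_k-L_{-k}$, $k\ge1$. For $n\in\mathbb N$, $\mathcal F_n\mathcal O=\mathrm{span}\{\mathcal U_k\mid k\ge n\}$ (a subalgebra). For a Lie algebra homomorphism $\varphi_n\colon\mathcal F_n\mathcal O\to\Bbbk$, let $\Bbbk_{\varphi_n}=\Bbbk1_{\varphi_n}$ with $x\cdot1_{\varphi_n}=\varphi_n(x)1_{\varphi_n}$, and $M_{\varphi_n}=\mathrm{Ind}_{\mathcal F_n\mathcal O}^{\mathcal O}\Bbbk_{\varphi_n}=U(\mathcal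 O)\otimes_{U(\mathcal F_n\mathcal O)}\Bbbk_{\varphi_n}$. *)

theory Defs
  imports Main
begin

text \<open>Free associative algebra over 'k on generators indexed by nat; the generator with
  index m stands for U_(m-1), m >= 0. Elements are finitely supported functions on words.\<close>

definition fa :: "(nat list \<Rightarrow> 'k::field) set" where
  "fa = {f. finite {w. f w \<noteq> 0}}"

definition fa_add :: "(nat list \<Rightarrow> 'k::field) \<Rightarrow> (nat list \<Rightarrow> 'k) \<Rightarrow> (nat list \<Rightarrow> 'k)" where
  "fa_add f g = (\<lambda>w. f w + g w)"

definition fa_smult :: "'k::field \<Rightarrow> (nat list \<Rightarrow> 'k) \<Rightarrow> (nat list \<Rightarrow> 'k)" where
  "fa_smult c f = (\<lambda>w. c * f w)"

definition fa_zero :: "nat list \<Rightarrow> 'k::field" where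
  "fa_zero = (\<lambda>w. 0)"

definition fa_one :: "nat list \<Rightarrow> 'k::field" where
  "fa_one = (\<lambda>w. if w = [] then 1 else 0)"

definition fa_mul :: "(nat list \<Rightarrow> 'k::field) \<Rightarrow> (nat list \<Rightarrow> 'k) \<Rightarrow> (nat list \<Rightarrow> 'k)" where
  "fa_mul f g = (\<lambda>w. \<Sum>i\<le>length w. f (take i w) * g (drop i w))"

definition fa_minus :: "(nat list \<Rightarrow> 'k::field) \<Rightarrow> (nat list \<Rightarrow> 'k) \<Rightarrow> (nat list \<Rightarrow> 'k)" where
  "fa_minus f g = (\<lambda>w. f w - g w)"

text \<open>The generator U_n (n an integer); U_n = 0 for n < -1 (convention U_(-2) = U_(-3) = 0).\<close>
definition Ugen :: "int \<Rightarrow> (nat list \<Rightarrow> 'k::field)" where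
  "Ugen n = (if n \<ge> -1 then (\<lambda>w. if w = [nat (n + 1)] then 1 else 0) else fa_zero)"

text \<open>Defining relations of U(O): U_i U_j - U_j U_i - [U_i,U_j].\<close>
definition Orel :: "int \<Rightarrow> int \<Rightarrow> (nat list \<Rightarrow> 'k::field)" where
  "Orel i j = fa_minus (fa_minus (fa_mul (Ugen i) (Ugen j)) (fa_mul (Ugen j) (Ugen i)))
      (fa_smult (of_int (i - j)) (fa_minus (Ugen (i + j + 2)) (fa_smult 4 (Ugen (i + j)))))"

definition left_ideal :: "(nat list \<Rightarrow> 'k::field) set \<Rightarrow> bool" where
  "left_ideal L \<longleftrightarrow> L \<subseteq> fa \<and> fa_zero \<in> L \<and>
     (\<forall>x\<in>L. \<forall>y\<in>L. fa_add x y \<in> L) \<and> (\<forall>a\<in>fa. \<forall>x\<in>L. fa_mul a x \<in> L)"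

text \<open>Kernel of the surjection T(O) -> M_phi = U(O) \<otimes>_{U(F_n O)} k_phi: the left ideal generated
  by the two-sided ideal of U(O)-relations and the elements U_k - phi(U_k), k >= n.\<close>
definition whittaker_kernel :: "(int \<Rightarrow> 'k::field) \<Rightarrow> nat \<Rightarrow> (nat list \<Rightarrow> 'k) set" where
  "whittaker_kernel phi n = \<Inter> {L. left_ideal L \<and>
      (\<forall>i j. i \<ge> -1 \<longrightarrow> j \<ge> -1 \<longrightarrow> (\<forall>b\<in>fa. fa_mul (Orel i j) b \<in> L)) \<and>
      (\<forall>k. k \<ge> int n \<longrightarrow> fa_minus (Ugen k) (fa_smult (phi k) fa_one) \<in> L)}"

definition Wcoset :: "(int \<Rightarrow> 'k::field) \<Rightarrow> nat \<Rightarrow> (nat list \<Rightarrow> 'k) \<Rightarrow> (nat list \<Rightarrow> 'k) set" where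
  "Wcoset phi n x = {y \<in> fa. fa_minus x y \<in> whittaker_kernel phi n}"

definition Wmodule :: "(int \<Rightarrow> 'k::field) \<Rightarrow> nat \<Rightarrow> (nat list \<Rightarrow> 'k) set set" where
  "Wmodule phi n = Wcoset phi n ` fa"

definition W_submodule :: "(int \<Rightarrow> 'k::field) \<Rightarrow> nat \<Rightarrow> (nat list \<Rightarrow> 'k) set set \<Rightarrow> bool" where
  "W_submodule phi n N \<longleftrightarrow> N \<subseteq> Wmodule phi n \<and> Wcoset phi n fa_zero \<in> N \<and>
     (\<forall>x\<in>fa. \<forall>y\<in>fa. Wcoset phi n x \<in> N \<longrightarrow> Wcoset phi n y \<in> N \<longrightarrow> Wcoset phi n (fa_add x y) \<in> N) \<and>
     (\<forall>c. \<forall>x\<in>fa. Wcoset phi n x \<in> N \<longrightarrow> Wcoset phi n (fa_smult c x) \<in> N) \<and>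
     (\<forall>k. k \<ge> -1 \<longrightarrow> (\<forall>x\<in>fa. Wcoset phi n x \<in> N \<longrightarrow> Wcoset phi n (fa_mul (Ugen k) x) \<in> N))"

definition W_irreducible :: "(int \<Rightarrow> 'k::field) \<Rightarrow> nat \<Rightarrow> bool" where
  "W_irreducible phi n \<longleftrightarrow> Wmodule phi n \<noteq> {Wcoset phi n fa_zero} \<and>
     (\<forall>N. W_submodule phi n N \<longrightarrow> N = {Wcoset phi n fa_zero} \<or> N = Wmodule phi n)"

text \<open>phi : F_n O -> k given by its values phi k = phi(U_k), k >= n; Lie homomorphism means
  phi([U_i,U_j]) = 0 for all i, j >= n.\<close>
definition lie_hom_Fn :: "nat \<Rightarrow> (int \<Rightarrow> 'k::field) \<Rightarrow> bool" where
  "lie_hom_Fn n phi \<longleftrightarrow> (\<forall>i j. i \<ge> int n \<longrightarrow> j \<ge> int n \<longrightarrow>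
      of_int (i - j) * (phi (i + j + 2) - 4 * phi (i + j)) = 0)"

end

theory Submission
  imports Defs Complex_Main "HOL-Library.Multiset" "HOL-Library.Function_Algebras"
begin

text \<open>
  Put \<open>\<psi>(k) = \<phi>(U\<^sub>k\<^sub>+\<^sub>2) - 4 \<phi>(U\<^sub>k)\<close>; a homomorphism \<open>\<phi>\<close> on \<open>F\<^sub>n O\<close> has \<open>\<psi>(k) = 0\<close> for \<open>k > 2n\<close>.
  If \<open>\<psi>\<close> also vanishes at \<open>2n\<close> and (for \<open>n \<ge> 1\<close>) at \<open>2n - 1\<close>, then \<open>\<phi>\<close> extends by some value \<open>c\<close> at \<open>U\<^sub>n\<^sub>-\<^sub>1\<close>,
  and the module induced from the extension is a proper quotient, killing \<open>(U\<^sub>n\<^sub>-\<^sub>1 - c) 1\<close>. That this quotient and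
  its kernel are nonzero follows from the PBW theorem, in the form of linear functionals on words which
  respect the defining relations and are prescribed on sorted words.

  Otherwise let \<open>e \<in> {2n - 1, 2n}\<close> be maximal with \<open>\<psi>(e) \<noteq> 0\<close>. Twisting by a character of \<open>O\<close> makes
  \<open>\<phi>(U\<^sub>k) = 0\<close> for \<open>k > e\<close>. Give \<open>U\<^sub>k\<close> the weight \<open>e - k\<close>. Brackets then lower the weight by at least \<open>e\<close>,
  vectors of negative weight vanish, and for \<open>n \<ge> 1\<close> the operators \<open>U\<^sub>e\<^sub>-\<^sub>k - \<phi>(U\<^sub>e\<^sub>-\<^sub>k)\<close> act on the associated
  graded polynomial ring essentially as nonzero multiples of \<open>d/dU\<^sub>k\<close>, so that a suitable product of them
  takes any nonzero vector to a nonzero multiple of the generator. For \<open>n = 0\<close> we have \<open>e = 0\<close> and the graded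
  ring is not commutative; there the leading coefficients of \<open>U\<^sub>1\<close> and \<open>U\<^sub>2\<close> on \<open>U\<^sub>-\<^sub>1\<^sup>k 1\<close> are computed directly,
  and they do not vanish simultaneously.

  As in \<open>fa\<close>, the letter \<open>a :: nat\<close> stands for \<open>U\<^sub>a\<^sub>-\<^sub>1\<close>, so the bracket of the letters \<open>a\<close> and \<open>b\<close> is \<open>a - b\<close> times
  the letter \<open>a + b + 1\<close> minus four times the letter \<open>a + b - 1\<close>. The subtraction in \<open>a + b - 1\<close> is truncated
  only for \<open>a = b = 0\<close>, where the factor \<open>a - b\<close> is zero. The subalgebra \<open>F\<^sub>n O\<close> consists of the letters \<open>\<ge> N = n + 1\<close>.
\<close>

section \<open>Straightening functionals on words\<close>

lemma not_sorted_leftmost_descent: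
  "\<not> sorted w \<Longrightarrow> \<exists>u a b v. w = u @ a # b # v \<and> b < a \<and> sorted (u @ [a])" for w :: "nat list"
proof (induction w)
  case (Cons x xs)
  show ?case
  proof (cases "sorted xs")
    case True
    then obtain y ys where "xs = y # ys" "y < x"
      using Cons.prems by (cases xs) (auto simp: not_le)
    then have "x # xs = [] @ x # y # ys \<and> y < x \<and> sorted ([] @ [x])" by simp
    then show ?thesis by blast
  next
    case False
    then obtain u a b v where d: "xs = u @ a # b # v" "b < a" "sorted (u @ [a])"
      using Cons.IH by blast
    show ?thesis
    proof (cases "sorted (x # u @ [a])")
      case True
      then have "x # xs = (x # u) @ a # b # v \<and> b < a \<and> sorted ((x # u) @ [a])" using d by simp
      then show ?thesis by blast
    next
      case False
      obtain y ys where y: "u @ [a] = y # ys" by (cases "u @ [a]") auto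
      then have "y < x" using False d(3) by (auto simp: not_le)
      moreover have "x # xs = [] @ x # y # ys @ b # v"
        using y d(1) by (metis append.assoc append_Cons append_Nil)
      ultimately have "x # xs = [] @ x # y # (ys @ b # v) \<and> y < x \<and> sorted ([] @ [x])" by simp
      then show ?thesis by blast
    qed
  qed
qed simp

lemma smaller_letter_lenlex:
  "b < a \<Longrightarrow> length s = length t \<Longrightarrow> (u @ b # s, u @ a # t) \<in> lenlex less_than" for a b :: nat
  by (induction u) (auto simp: Cons_lenlex_iff)

lemma swap_lenlex: "b < a \<Longrightarrow> (u @ b # a # v, u @ a # b # v) \<in> lenlex less_than"
  for a b :: nat
  by (rule smaller_letter_lenlex) auto

lemma shorter_lenlex: "length w' < length w \<Longrightarrow> (w', w) \<in> lenlex less_than"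
  by (simp add: lenlex_conv)

text \<open>The Jacobi identity for the letters \<open>a\<close>, \<open>i\<close>,
  \<open>j\<close>. Double brackets involve only the letters \<open>a + i + j + 2\<close>,
  \<open>a + i + j\<close> and \<open>a + i + j - 2\<close>; \<open>x\<close>, \<open>y\<close>,
  \<open>z\<close> are the values of a functional there.\<close>

lemma jacobi_identity_scalars:
  fixes a i j x y z :: "'k::field"
  shows "(a - i) * ((a + i + 1 - j) * (x - 4 * y) - 4 * ((a + i - 1 - j) * (y - 4 * z)))
    - (a - j) * ((a + j + 1 - i) * (x - 4 * y) - 4 * ((a + j - 1 - i) * (y - 4 * z)))
    + (i - j) * ((i + j + 1 - a) * (x - 4 * y) - 4 * ((i + j - 1 - a) * (y - 4 * z))) = 0"
  by algebra

lemma cancel_jacobi: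
  fixes p q r :: "'k::field"
  assumes "p = p' + x" "q = q' + y" "r = r' + z" "x - y + z = 0"
  shows "p + q' + r = p' + q + r'"
  using assms by algebra

lemma cancel_disjoint:
  fixes p q r s :: "'k::field"
  assumes "p - q = x" "r - s = y" "x = y"
  shows "p + s = q + r"
proof -
  have "p = x + q" "r = y + s" using assms(1,2) by (metis diff_add_cancel)+
  then show ?thesis using assms(3) by (simp add: ac_simps)
qed

text \<open>Brackets taken at two disjoint places of a word yield the same four words in either
  order.\<close>

lemma commuting_brackets:
  fixes s t p q r u :: "'k::field"
  shows "s * (t * (p - 4 * q) - 4 * (t * (r - 4 * u))) = t * (s * (p - 4 * r) - 4 * (s * (q - 4 * u)))"
  by algebra

lemma common_factor:
  fixes s x y p q :: "'k::field"
  shows "s * ((x + p) - 4 * (y + q)) - s * (x - 4 * y) = s * (p - 4 * q)"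
  by algebra

text \<open>Data for a functional on the module induced from the character \<open>\<Phi>\<close> of
  the letters \<open>\<ge> N\<close>. By PBW the sorted words in letters \<open>< N\<close> form a
  basis of that module, so \<open>g\<close> may be arbitrary.\<close>

locale straightening =
  fixes N :: nat and \<Phi> :: "nat \<Rightarrow> 'k::field" and g :: "nat list \<Rightarrow> 'k"
  assumes char: "\<And>a b. a \<ge> N \<Longrightarrow> b \<ge> N \<Longrightarrow>
      (of_nat a - of_nat b) * (\<Phi> (a + b + 1) - 4 * \<Phi> (a + b - 1)) = 0"
begin

text \<open>In a sorted word the letters \<open>\<ge> N\<close> stand at the right end, next to the
  generator, where they act by \<open>\<Phi>\<close>.\<close>

definition base :: "nat list \<Rightarrow> 'k" where
  "base w = g (takeWhile (\<lambda>a. a < N) w) * prod_list (map \<Phi> (dropWhile (\<lambda>a. a < N) w))"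

definition descent :: "nat list \<Rightarrow> nat list \<times> nat \<times> nat \<times> nat list" where
  "descent w = (SOME (u, a, b, v). w = u @ a # b # v \<and> b < a \<and> sorted (u @ [a]))"

lemma descent_eq:
  assumes "\<not> sorted w" "descent w = (u, a, b, v)"
  shows "w = u @ a # b # v" "b < a" "sorted (u @ [a])"
proof -
  have "\<exists>p. case p of (u, a, b, v) \<Rightarrow> w = u @ a # b # v \<and> b < a \<and> sorted (u @ [a])"
    using not_sorted_leftmost_descent[OF assms(1)] by auto
  from someI_ex[OF this] show "w = u @ a # b # v" "b < a" "sorted (u @ [a])"
    using assms(2) unfolding descent_def by auto
qed

lemma descent_lenlex:
  assumes "(u, a, b, v) = descent w" "\<not> sorted w"
  shows "(u @ b # a # v, w) \<in> lenlex less_than"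
    and "(u @ c # v, w) \<in> lenlex less_than"
  using descent_eq[OF assms(2) assms(1)[symmetric]] swap_lenlex shorter_lenlex by simp_all

text \<open>Fixing the leftmost descent makes this a recursion: the swapped word is
  lexicographically smaller and the bracket terms are shorter. That every other descent may be
  rewritten as well is proved in \<open>L_swap\<close>.\<close>

function L :: "nat list \<Rightarrow> 'k" where
  "L w = (if sorted w then base w else
     (case descent w of (u, a, b, v) \<Rightarrow>
        L (u @ b # a # v) + (of_nat a - of_nat b) * (L (u @ (a + b + 1) # v) - 4 * L (u @ (a + b - 1) # v))))"
  by auto
termination
  by (relation "lenlex less_than") (auto simp: wf_lenlex dest: descent_lenlex)

declare L.simps [simp del]

definition br :: "nat list \<Rightarrow> nat \<Rightarrow> nat \<Rightarrow> nat list \<Rightarrow> 'k" where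
  "br u a b v = (of_nat a - of_nat b) * (L (u @ (a + b + 1) # v) - 4 * L (u @ (a + b - 1) # v))"

lemma L_descent:
  assumes "\<not> sorted w"
  obtains u a b v where "w = u @ a # b # v" "b < a" "sorted (u @ [a])"
    "L w = L (u @ b # a # v) + br u a b v"
proof -
  obtain u a b v where d: "descent w = (u, a, b, v)" by (cases "descent w")
  have "L w = L (u @ b # a # v) + br u a b v"
    by (subst L.simps) (simp add: assms d br_def)
  with descent_eq[OF assms d] show ?thesis using that by blast
qed

lemma br_antisym: "br u a b v = - br u b a v"
  by (simp add: br_def add.commute algebra_simps)

text \<open>Confluence, as in the diamond lemma. The given descent and the leftmost one coincide,
  overlap in one letter, or are disjoint; in the last two cases both words are brought to a common
  one by steps that the induction hypothesis covers.\<close>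

lemma L_swap_less: "j < i \<Longrightarrow> L (u @ i # j # v) = L (u @ j # i # v) + br u i j v"
proof (induction "u @ i # j # v" arbitrary: u i j v rule: wf_induct_rule[OF wf_lenlex[OF wf_less_than]])
  case 1
  note IH = "1.hyps" and ij = "1.prems"
  let ?w = "u @ i # j # v"
  \<comment> \<open>Bracket terms are shorter words, and in these letters may be interchanged
    whatever their order.\<close>
  have short: "L (p @ x # y # q) = L (p @ y # x # q) + br p x y q"
    if len: "length p + length q < length u + length v" for p x y q
  proof (cases x y rule: linorder_cases)
    case less
    then have "L (p @ y # x # q) = L (p @ x # y # q) + br p y x q"
      by (intro IH shorter_lenlex) (use len in auto)
    then show ?thesis using br_antisym[of p x y q] by simp
  next
    case equal
    then show ?thesis by (simp add: br_def)
  next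
    case greater
    then show ?thesis by (intro IH shorter_lenlex) (use len in auto)
  qed
  have "\<not> sorted ?w" using ij by (auto simp: sorted_append)
  then obtain u' a b v' where d: "?w = u' @ a # b # v'" "b < a" "sorted (u' @ [a])"
    and Lw: "L ?w = L (u' @ b # a # v') + br u' a b v'"
    by (rule L_descent)
  \<comment> \<open>The prefix \<open>u' @ [a]\<close> is sorted, so it cannot contain the descent
    from \<open>i\<close> to \<open>j\<close>.\<close>
  have "length u' \<le> length u"
  proof (rule ccontr)
    assume "\<not> ?thesis"
    then have l: "length u < length u'" by simp
    have n: "(u' @ [a]) ! m = ?w ! m" if "m < length (u' @ [a])" for m
    proof -
      have "?w = (u' @ [a]) @ b # v'" using d(1) by simp
      then show ?thesis using that by (simp only: nth_append if_True)
    qed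
    have "?w ! length u = i" "?w ! Suc (length u) = j" by (simp_all add: nth_append)
    then have "(u' @ [a]) ! length u = i" "(u' @ [a]) ! Suc (length u) = j" using n l by simp_all
    moreover have "Suc (length u) < length (u' @ [a])" using l by simp
    ultimately show False using d(3) ij by (metis sorted_iff_nth_Suc not_le)
  qed
  then obtain z where z: "u = u' @ z" "z @ i # j # v = a # b # v'"
    using d(1) by (auto simp: append_eq_append_conv2)
  consider "z = []" | "z = [a]" | z' where "z = a # b # z'"
    using z(2) by (cases z; cases "tl z") auto
  then show ?case
  proof cases
    assume "z = []"
    then show ?thesis using z Lw by simp
  next
    assume z1: "z = [a]"
    then have e: "b = i" "v' = j # v" "u = u' @ [a]" "i < a" using z d(2) by auto
    \<comment> \<open>Overlap \<open>a > i > j\<close>: both ways of sorting the three letters end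
      in \<open>j # i # a\<close>, one by first swapping \<open>a\<close> with \<open>i\<close>, the
      other by first swapping \<open>i\<close> with \<open>j\<close>. The collected bracket terms
      agree by the Jacobi identity.\<close>
    have sm1: "L (u' @ i # a # j # v) = L (u' @ i # j # a # v) + br (u' @ [i]) a j v"
      using IH[of "u' @ [i]" a j v] swap_lenlex[of i a u' "j # v"] e ij by simp
    have "(u' @ i # j # a # v, u @ i # j # v) \<in> lenlex less_than"
      using smaller_letter_lenlex[of i a "j # a # v" "i # j # v" u'] e ij by simp
    then have sm2: "L (u' @ i # j # a # v) = L (u' @ j # i # a # v) + br u' i j (a # v)"
      using IH[of u' i j "a # v"] ij by simp
    have "(u' @ a # j # i # v, u @ i # j # v) \<in> lenlex less_than"
      using e swap_lenlex[of j i "u' @ [a]" v] ij by simp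
    then have sm3: "L (u' @ a # j # i # v) = L (u' @ j # a # i # v) + br u' a j (i # v)"
      using IH[of u' a j "i # v"] ij e by simp
    have "(u' @ j # a # i # v, u @ i # j # v) \<in> lenlex less_than"
      using smaller_letter_lenlex[of j a "a # i # v" "i # j # v" u'] e ij by simp
    then have sm4: "L (u' @ j # a # i # v) = L (u' @ j # i # a # v) + br (u' @ [j]) a i v"
      using IH[of "u' @ [j]" a i v] e by simp
    have sh: "L (u' @ x # y # v) = L (u' @ y # x # v) + br u' x y v" for x y
      by (rule short) (simp add: e)
    \<comment> \<open>Since \<open>a\<close> and \<open>i\<close> are positive, no subtraction
      inside the double brackets is truncated.\<close>
    obtain a' i' where ai: "a = Suc a'" "i = Suc i'" "i' < a'" "j \<le> i'"
      using e ij by (cases a; cases i) auto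
    have idx: "a + i + 1 + j + 1 = a' + i' + j + 4" "a + i + 1 + j - 1 = a' + i' + j + 2"
      "a + i - 1 + j + 1 = a' + i' + j + 2" "a + i - 1 + j - 1 = a' + i' + j"
      "a + j + 1 + i + 1 = a' + i' + j + 4" "a + j + 1 + i - 1 = a' + i' + j + 2"
      "a + j - 1 + i + 1 = a' + i' + j + 2" "a + j - 1 + i - 1 = a' + i' + j"
      "i + j + 1 + a + 1 = a' + i' + j + 4" "i + j + 1 + a - 1 = a' + i' + j + 2"
      "i + j - 1 + a + 1 = a' + i' + j + 2" "i + j - 1 + a - 1 = a' + i' + j"
      using ai by auto
    have jac: "(of_nat a - of_nat i) * (br u' (a + i + 1) j v - 4 * br u' (a + i - 1) j v)
        - (of_nat a - of_nat j) * (br u' (a + j + 1) i v - 4 * br u' (a + j - 1) i v)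
        + (of_nat i - of_nat j) * (br u' (i + j + 1) a v - 4 * br u' (i + j - 1) a v) = 0"
    proof -
      have cf: "of_nat (a + i + 1) = of_nat a + of_nat i + (1 :: 'k)"
        "of_nat (a + j + 1) = of_nat a + of_nat j + (1 :: 'k)"
        "of_nat (i + j + 1) = of_nat i + of_nat j + (1 :: 'k)"
        "of_nat (a + i - 1) = of_nat a + of_nat i - (1 :: 'k)"
        "of_nat (a + j - 1) = of_nat a + of_nat j - (1 :: 'k)"
        "of_nat (i + j - 1) = of_nat i + of_nat j - (1 :: 'k)"
        using ai by simp_all
      show ?thesis unfolding br_def idx cf by (rule jacobi_identity_scalars)
    qed
    \<comment> \<open>Moving the letter created by a bracket past the third letter costs a double
      bracket.\<close>
    have b1: "br u' a i (j # v) = br (u' @ [j]) a i v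
        + (of_nat a - of_nat i) * (br u' (a + i + 1) j v - 4 * br u' (a + i - 1) j v)"
      using sh[of "a + i + 1" j] sh[of "a + i - 1" j] unfolding br_def[of u' a i] br_def[of "u' @ [j]"]
      by (simp add: algebra_simps)
    have b2: "br u' a j (i # v) = br (u' @ [i]) a j v
        + (of_nat a - of_nat j) * (br u' (a + j + 1) i v - 4 * br u' (a + j - 1) i v)"
      using sh[of "a + j + 1" i] sh[of "a + j - 1" i] unfolding br_def[of u' a j] br_def[of "u' @ [i]"]
      by (simp add: algebra_simps)
    have b3: "br u' i j (a # v) = br (u' @ [a]) i j v
        + (of_nat i - of_nat j) * (br u' (i + j + 1) a v - 4 * br u' (i + j - 1) a v)"
      using sh[of "i + j + 1" a] sh[of "i + j - 1" a] unfolding br_def[of u' i j] br_def[of "u' @ [a]"]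
      by (simp add: algebra_simps)
    have "L (u @ i # j # v) = L (u' @ i # a # j # v) + br u' a i (j # v)"
      using Lw e by simp
    moreover have "L (u @ j # i # v) = L (u' @ a # j # i # v)" using e by simp
    moreover have "br u i j v = br (u' @ [a]) i j v" using e by simp
    moreover have "br u' a i (j # v) + br (u' @ [i]) a j v + br u' i j (a # v)
        = br (u' @ [j]) a i v + br u' a j (i # v) + br (u' @ [a]) i j v"
      using b1 b2 b3 jac by (rule cancel_jacobi)
    ultimately show ?thesis
      using sm1 sm2 sm3 sm4 by (simp add: add.assoc add.commute add.left_commute)
  next
    fix z' assume z1: "z = a # b # z'"
    then have e: "u = u' @ a # b # z'" "v' = z' @ i # j # v" using z by auto
    have "(u' @ b # a # z' @ i # j # v, u @ i # j # v) \<in> lenlex less_than"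
      using e swap_lenlex[OF d(2)] by simp
    then have s1: "L (u' @ b # a # z' @ i # j # v)
        = L (u' @ b # a # z' @ j # i # v) + br (u' @ b # a # z') i j v"
      using IH[of "u' @ b # a # z'" i j v] ij by simp
    have "(u' @ a # b # z' @ j # i # v, u @ i # j # v) \<in> lenlex less_than"
      using e swap_lenlex[of j i u v] ij by simp
    then have s2: "L (u' @ a # b # z' @ j # i # v)
        = L (u' @ b # a # z' @ j # i # v) + br u' a b (z' @ j # i # v)"
      using IH[of u' a b "z' @ j # i # v"] d(2) by simp
    have s3: "L (u' @ c # z' @ i # j # v) = L (u' @ c # z' @ j # i # v) + br (u' @ c # z') i j v" for c
      using short[of "u' @ c # z'" v i j] e by simp
    have s4: "L (u' @ a # b # z' @ c # v) = L (u' @ b # a # z' @ c # v) + br u' a b (z' @ c # v)" for c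
      using short[of u' "z' @ c # v" a b] e by simp
    \<comment> \<open>Disjoint descents: the difference made by the second rewriting inside the
      bracket of the first is a double bracket, symmetric in the two places.\<close>
    have "br u' a b (z' @ i # j # v) - br u' a b (z' @ j # i # v)
        = (of_nat a - of_nat b) * (br (u' @ (a + b + 1) # z') i j v - 4 * br (u' @ (a + b - 1) # z') i j v)"
      unfolding br_def[of u' a b] s3[of "a + b + 1"] s3[of "a + b - 1"] by (simp add: algebra_simps)
    moreover have "br (u' @ a # b # z') i j v - br (u' @ b # a # z') i j v
        = (of_nat i - of_nat j) * (br u' a b (z' @ (i + j + 1) # v) - 4 * br u' a b (z' @ (i + j - 1) # v))"
      unfolding br_def[of "u' @ a # b # z'"] br_def[of "u' @ b # a # z'"] append_assoc append_Cons
        s4[of "i + j + 1"] s4[of "i + j - 1"] by (rule common_factor)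
    moreover have "(of_nat a - of_nat b) * (br (u' @ (a + b + 1) # z') i j v - 4 * br (u' @ (a + b - 1) # z') i j v)
        = (of_nat i - of_nat j) * (br u' a b (z' @ (i + j + 1) # v) - 4 * br u' a b (z' @ (i + j - 1) # v))"
      unfolding br_def append_assoc append_Cons by (rule commuting_brackets)
    ultimately have "br u' a b (z' @ i # j # v) + br (u' @ b # a # z') i j v
        = br u' a b (z' @ j # i # v) + br (u' @ a # b # z') i j v"
      by (rule cancel_disjoint)
    moreover have "L (u @ i # j # v) = L (u' @ b # a # z' @ i # j # v) + br u' a b (z' @ i # j # v)"
      using Lw e by simp
    moreover have "L (u @ j # i # v) = L (u' @ a # b # z' @ j # i # v)" "br u i j v = br (u' @ a # b # z') i j v"
      using e by simp_all
    ultimately show ?thesis using s1 s2 by (simp add: add.assoc add.commute add.left_commute)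
  qed
qed

lemma L_swap: "L (u @ i # j # v) = L (u @ j # i # v) + br u i j v"
  using L_swap_less[of j i u v] L_swap_less[of i j u v] br_antisym[of u i j v]
  by (cases i j rule: linorder_cases) (auto simp: br_def)

text \<open>This makes the functional factor through the induced module. The word is sorted by
  induction; when \<open>u\<close> is sorted and its last letter exceeds \<open>k\<close>, both
  letters are \<open>\<ge> N\<close>, and their bracket contributes zero because
  \<open>\<Phi>\<close> is a character.\<close>

lemma L_snoc: "k \<ge> N \<Longrightarrow> L (u @ [k]) = \<Phi> k * L u"
proof (induction "u @ [k]" arbitrary: u k rule: wf_induct_rule[OF wf_lenlex[OF wf_less_than]])
  case 1
  note IH = "1.hyps" and k = "1.prems"
  show ?case
  proof (cases "sorted u")
    case False
    then obtain p a b v where d: "u = p @ a # b # v" "b < a"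
      using not_sorted_leftmost_descent by blast
    have "L (p @ b # a # v @ [k]) = \<Phi> k * L (p @ b # a # v)"
      using IH[of "p @ b # a # v" k] swap_lenlex[of b a p "v @ [k]"] d k by simp
    moreover have "L (p @ c # v @ [k]) = \<Phi> k * L (p @ c # v)" for c
      using IH[of "p @ c # v" k] shorter_lenlex d k by simp
    moreover have "br p a b (v @ [k]) = \<Phi> k * br p a b v"
      using calculation(2)[of "a + b + 1"] calculation(2)[of "a + b - 1"] by (simp add: br_def algebra_simps)
    ultimately show ?thesis
      using L_swap[of p a b "v @ [k]"] L_swap[of p a b v] d by (simp add: distrib_left)
  next
    case su: True
    show ?thesis
    proof (cases "sorted (u @ [k])")
      case True
      have "base (u @ [k]) = \<Phi> k * base u"
      proof (cases "\<forall>x\<in>set u. x < N")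
        case True
        then have "takeWhile (\<lambda>a. a < N) u = u" "dropWhile (\<lambda>a. a < N) u = []"
          by auto
        then show ?thesis using k True unfolding base_def
          by (simp add: takeWhile_append dropWhile_append del: takeWhile_eq_all_conv dropWhile_eq_Nil_conv)
      next
        case False
        then show ?thesis unfolding base_def
          by (auto simp: takeWhile_append dropWhile_append)
      qed
      then show ?thesis using True su by (simp add: L.simps)
    next
      case False
      then obtain u' j where u: "u = u' @ [j]" using su by (cases u rule: rev_cases) auto
      have jk: "k < j"
      proof (rule ccontr)
        assume "\<not> k < j"
        then have "sorted (u @ [k])" using su unfolding u by (auto simp: sorted_append)
        then show False using False by simp
      qed
      have "L (u' @ [k, j]) = \<Phi> j * L (u' @ [k])"
        using IH[of "u' @ [k]" j] swap_lenlex[OF jk, of u' "[]"] jk k u by simp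
      moreover have "L (u' @ [c]) = \<Phi> c * L u'" if "c \<ge> N" for c
        using IH[of u' c] that u shorter_lenlex by simp
      moreover have "br u' j k [] = (of_nat j - of_nat k) * (\<Phi> (j + k + 1) - 4 * \<Phi> (j + k - 1)) * L u'"
        using calculation(2)[of "j + k + 1"] calculation(2)[of "j + k - 1"] k jk
        unfolding br_def by (simp add: algebra_simps)
      ultimately show ?thesis
        using L_swap[of u' j k "[]"] u k jk char[of j k] by simp
    qed
  qed
qed

lemma L_sorted: "sorted w \<Longrightarrow> L w = base w"
  by (simp add: L.simps)

end

section \<open>Modules generated by a Whittaker vector\<close>

text \<open>The module is the quotient \<open>C / K\<close>; its elements are handled as vectors of \<open>C\<close> modulo \<open>K\<close>.\<close>

locale word_module = vector_space scale
  for scale :: "'k::field_char_0 \<Rightarrow> 'v::ab_group_add \<Rightarrow> 'v" (infixr \<open>*s\<close> 75) +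
  fixes X :: "nat \<Rightarrow> 'v \<Rightarrow> 'v" and C K :: "'v set" and v0 :: 'v and \<Phi> :: "nat \<Rightarrow> 'k" and N :: nat
  assumes X_add: "X a (x + y) = X a x + X a y"
    and X_scale: "X a (c *s x) = c *s X a x"
    and subspace_C: "subspace C" and subspace_K: "subspace K"
    and v0_in_C: "v0 \<in> C"
    and X_in_C: "x \<in> C \<Longrightarrow> X a x \<in> C"
    and X_in_K: "x \<in> K \<Longrightarrow> X a x \<in> K"
    and X_comm: "x \<in> C \<Longrightarrow> X a (X b x) - X b (X a x)
        - (of_nat a - of_nat b) *s (X (a + b + 1) x - 4 *s X (a + b - 1) x) \<in> K"
    and C_cyclic: "subspace S \<Longrightarrow> v0 \<in> S \<Longrightarrow> (\<And>a x. x \<in> S \<Longrightarrow> X a x \<in> S) \<Longrightarrow> C \<subseteq> S"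
    and X_v0: "a \<ge> N \<Longrightarrow> X a v0 - \<Phi> a *s v0 \<in> K"
begin

lemma X_0 [simp]: "X a 0 = 0" using X_scale[of a 0 0] by simp
lemma X_minus: "X a (- x) = - X a x"
  using X_add[of a x "- x"] by (simp add: eq_neg_iff_add_eq_0 add.commute)
lemma X_diff: "X a (x - y) = X a x - X a y"
  using X_add[of a x "- y"] by (simp add: X_minus)

lemmas X_linear = X_add X_scale X_diff

lemma K_add: "x \<in> K \<Longrightarrow> y \<in> K \<Longrightarrow> x + y \<in> K" using subspace_K by (rule subspace_add)
lemma K_diff: "x \<in> K \<Longrightarrow> y \<in> K \<Longrightarrow> x - y \<in> K" using subspace_K by (rule subspace_diff)
lemma K_scale: "x \<in> K \<Longrightarrow> c *s x \<in> K" using subspace_K by (rule subspace_scale)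
lemma K_0 [simp]: "0 \<in> K" using subspace_K by (rule subspace_0)

lemma subspace_scale_cancel: "subspace S \<Longrightarrow> c *s x \<in> S \<Longrightarrow> c \<noteq> 0 \<Longrightarrow> x \<in> S"
  using subspace_scale[of S "c *s x" "inverse c"] by simp

definition W :: "nat list \<Rightarrow> 'v" where "W w = foldr X w v0"

lemma W_Nil [simp]: "W [] = v0" by (simp add: W_def)
lemma W_Cons: "W (a # w) = X a (W w)" by (simp add: W_def)

lemma W_in_C: "W w \<in> C"
  by (induction w) (auto simp: W_Cons v0_in_C X_in_C)

lemma W_swap: "W (u @ a # b # v) - W (u @ b # a # v)
    - (of_nat a - of_nat b) *s (W (u @ (a + b + 1) # v) - 4 *s W (u @ (a + b - 1) # v)) \<in> K"
proof (induction u)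
  case Nil
  then show ?case using X_comm[OF W_in_C] by (simp add: W_Cons)
next
  case (Cons c u)
  then show ?case using X_in_K[OF Cons, of c] by (simp add: W_Cons X_linear)
qed

lemma W_snoc: "a \<ge> N \<Longrightarrow> W (u @ [a]) - \<Phi> a *s W u \<in> K"
proof (induction u)
  case Nil
  then show ?case using X_v0 by (simp add: W_Cons)
next
  case (Cons c u)
  then show ?case using X_in_K[OF Cons(1), of c] by (simp add: W_Cons X_linear)
qed

section \<open>Sorted words span the module\<close>

lemma X_span:
  assumes "\<And>x. x \<in> A \<Longrightarrow> X a x \<in> span B" "x \<in> span A"
  shows "X a x \<in> span B"
  using assms(2)
  by (induction rule: span_induct_alt) (simp_all add: X_linear assms(1) span_zero span_add span_scale)

text \<open>The spanning half of PBW: the rewriting used for \<open>L\<close>, now with final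
  letters \<open>\<ge> N\<close> replaced by scalars, modulo \<open>K\<close>.\<close>

lemma W_in_span_sorted: "W w \<in> span (K \<union> W ` {w. sorted w \<and> set w \<subseteq> {..<N}})"
proof (induction w rule: wf_induct_rule[OF wf_lenlex[OF wf_less_than]])
  case (1 w)
  let ?S = "span (K \<union> W ` {w. sorted w \<and> set w \<subseteq> {..<N}})"
  have K: "x \<in> ?S" if "x \<in> K" for x using that by (intro span_base) auto
  show ?case
  proof (cases "sorted w")
    case False
    then obtain u a b v where w: "w = u @ a # b # v" "b < a" using not_sorted_leftmost_descent by blast
    have "W (u @ b # a # v) \<in> ?S" "W (u @ (a + b + 1) # v) \<in> ?S" "W (u @ (a + b - 1) # v) \<in> ?S"
      by (rule 1, simp add: w swap_lenlex shorter_lenlex)+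
    then have "W (u @ b # a # v) + (of_nat a - of_nat b) *s (W (u @ (a + b + 1) # v) - 4 *s W (u @ (a + b - 1) # v)) \<in> ?S"
      by (intro span_add span_scale span_diff)
    from span_add[OF this K[OF W_swap[of u a b v]]] show ?thesis using w by simp
  next
    case sorted: True
    show ?thesis
    proof (cases "set w \<subseteq> {..<N}")
      case True
      then show ?thesis using sorted by (intro span_base) auto
    next
      case False
      then obtain u a where w: "w = u @ [a]" by (cases w rule: rev_cases) auto
      have "a \<ge> N" using False sorted w by (auto simp: sorted_append dest!: subsetD)
      from K[OF W_snoc[OF this, of u]] have "W w - \<Phi> a *s W u \<in> ?S" using w by simp
      moreover have "W u \<in> ?S" using w by (intro 1) (simp add: lenlex_conv)
      ultimately have "(W w - \<Phi> a *s W u) + \<Phi> a *s W u \<in> ?S" by (intro span_add span_scale)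
      then show ?thesis by simp
    qed
  qed
qed

lemma C_subset_span_sorted: "C \<subseteq> span (K \<union> W ` {w. sorted w \<and> set w \<subseteq> {..<N}})"
proof -
  have "C \<subseteq> span (K \<union> range W)"
  proof (rule C_cyclic)
    show "v0 \<in> span (K \<union> range W)" by (metis W_Nil UnI2 rangeI span_base)
    show "X a x \<in> span (K \<union> range W)" if "x \<in> span (K \<union> range W)" for a x
      using _ that by (rule X_span) (auto simp: W_Cons[symmetric] X_in_K intro: span_base)
  qed auto
  also have "\<dots> \<subseteq> span (K \<union> W ` {w. sorted w \<and> set w \<subseteq> {..<N}})"
    by (rule span_minimal) (auto intro: span_base W_in_span_sorted)
  finally show ?thesis .
qed

lemma combination_of_words:
  assumes "x \<in> span (K \<union> W ` B)"
  shows "\<exists>F c. finite F \<and> F \<subseteq> B \<and> (\<forall>w\<in>F. c w \<noteq> 0) \<and> x - (\<Sum>w\<in>F. c w *s W w) \<in> K"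
proof -
  have "\<exists>F c. finite F \<and> F \<subseteq> B \<and> x - (\<Sum>w\<in>F. c w *s W w) \<in> K"
    using assms
  proof (induction rule: span_induct_alt)
    case base
    show ?case by (rule exI[of _ "{}"]) simp
  next
    case (step d y x)
    then obtain F c where F: "finite F" "F \<subseteq> B" "x - (\<Sum>w\<in>F. c w *s W w) \<in> K" by blast
    from step(1) show ?case
    proof
      assume "y \<in> K"
      then have "d *s y + (x - (\<Sum>w\<in>F. c w *s W w)) \<in> K" using F by (intro K_add K_scale)
      then show ?thesis using F by (intro exI[of _ F] exI[of _ c]) (simp add: algebra_simps)
    next
      assume "y \<in> W ` B"
      then obtain u where u: "u \<in> B" "y = W u" by auto
      define c' where "c' = (\<lambda>w. if w = u then d + (if u \<in> F then c u else 0) else c w)"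
      have "(\<Sum>w\<in>insert u F. c' w *s W w) = c' u *s W u + (\<Sum>w\<in>F - {u}. c w *s W w)"
        using F(1) by (simp add: sum.insert_remove) (rule sum.cong, auto simp: c'_def)
      moreover have "(\<Sum>w\<in>F. c w *s W w) = (if u \<in> F then c u else 0) *s W u + (\<Sum>w\<in>F - {u}. c w *s W w)"
        using F(1) by (auto simp: sum.remove)
      ultimately have "(\<Sum>w\<in>insert u F. c' w *s W w) = d *s W u + (\<Sum>w\<in>F. c w *s W w)"
        by (simp add: c'_def scale_left_distrib add.assoc)
      then show ?thesis using F u
        by (intro exI[of _ "insert u F"] exI[of _ c']) (simp add: algebra_simps)
    qed
  qed
  then obtain F c where F: "finite F" "F \<subseteq> B" "x - (\<Sum>w\<in>F. c w *s W w) \<in> K" by blast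
  have "(\<Sum>w\<in>F. c w *s W w) = (\<Sum>w\<in>{w\<in>F. c w \<noteq> 0}. c w *s W w)"
    by (rule sum.mono_neutral_cong_right) (use F in auto)
  then show ?thesis using F by (intro exI[of _ "{w\<in>F. c w \<noteq> 0}"] exI[of _ c]) auto
qed

end

section \<open>The weight filtration\<close>

locale filtered_word_module = word_module scale X C K v0 \<Phi> N
  for scale :: "'k::field_char_0 \<Rightarrow> 'v::ab_group_add \<Rightarrow> 'v" (infixr \<open>*s\<close> 75)
    and X C K v0 \<Phi> N +
  fixes e :: nat
  assumes \<Phi>_above: "a > e + 1 \<Longrightarrow> \<Phi> a = 0"
    and N_le: "N \<le> e + 1"
begin

definition wt :: "nat list \<Rightarrow> int" where "wt w = (\<Sum>a\<leftarrow>w. int e + 1 - int a)"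

lemma wt_simps [simp]: "wt [] = 0" "wt (a # w) = int e + 1 - int a + wt w" "wt (u @ v) = wt u + wt v"
  by (auto simp: wt_def)

definition G :: "int \<Rightarrow> 'v set" where "G d = span (K \<union> W ` {w. wt w \<le> d})"

text \<open>Home of the error terms of a rearrangement. The bound on the length is what the
  induction in \<open>W_negative_weight\<close> runs on.\<close>

definition H :: "nat \<Rightarrow> int \<Rightarrow> 'v set" where "H m d = span (K \<union> W ` {w. length w < m \<and> wt w \<le> d})"

lemma subspace_G: "subspace (G d)" by (simp add: G_def)
lemma G_add: "x \<in> G d \<Longrightarrow> y \<in> G d \<Longrightarrow> x + y \<in> G d" by (simp add: G_def span_add)
lemma G_diff: "x \<in> G d \<Longrightarrow> y \<in> G d \<Longrightarrow> x - y \<in> G d" by (simp add: G_def span_diff)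
lemma G_scale: "x \<in> G d \<Longrightarrow> c *s x \<in> G d" by (simp add: G_def span_scale)
lemma K_in_G: "x \<in> K \<Longrightarrow> x \<in> G d" by (simp add: G_def span_base)
lemma W_in_G: "wt w \<le> d \<Longrightarrow> W w \<in> G d" by (simp add: G_def span_base)
lemma G_mono: "c \<le> d \<Longrightarrow> x \<in> G c \<Longrightarrow> x \<in> G d"
  using span_mono[of "K \<union> W ` {w. wt w \<le> c}" "K \<union> W ` {w. wt w \<le> d}"] unfolding G_def by force
lemma H_subset_G: "x \<in> H m d \<Longrightarrow> x \<in> G d"
  using span_mono[of "K \<union> W ` {w. length w < m \<and> wt w \<le> d}" "K \<union> W ` {w. wt w \<le> d}"]
  unfolding G_def H_def by blast

lemma G_shift:
  assumes "x \<in> G d" "d + (int e + 1 - int a) \<le> d'"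
  shows "X a x \<in> G d'"
  unfolding G_def
proof (rule X_span)
  show "x \<in> span (K \<union> W ` {w. wt w \<le> d})" using assms(1) by (simp add: G_def)
qed (use assms(2) in \<open>auto simp: X_in_K W_Cons[symmetric] intro: span_base\<close>)

text \<open>The letters \<open>a + b + 1\<close> and \<open>a + b - 1\<close> weigh
  \<open>e + 2\<close> and \<open>e\<close> less than \<open>a\<close> and \<open>b\<close>
  together, and a bracket has one letter fewer.\<close>

lemma bracket_in_H:
  assumes "length (u @ a # b # v) \<le> m" "wt (u @ a # b # v) - int e \<le> d"
  shows "W (u @ a # b # v) - W (u @ b # a # v) \<in> H m d"
proof -
  let ?r = "(of_nat a - of_nat b) *s (W (u @ (a + b + 1) # v) - 4 *s W (u @ (a + b - 1) # v))"
  have "?r \<in> H m d"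
  proof (cases "a = b")
    case True
    then show ?thesis by (simp add: H_def span_zero)
  next
    case False
    then have "int (a + b - 1) = int a + int b - 1" by (simp add: of_nat_diff)
    then show ?thesis using assms unfolding H_def
      by (intro span_scale span_diff span_base UnI2 imageI) auto
  qed
  moreover have "W (u @ a # b # v) - W (u @ b # a # v) - ?r \<in> H m d"
    unfolding H_def using W_swap by (intro span_base) blast
  ultimately have "(W (u @ a # b # v) - W (u @ b # a # v) - ?r) + ?r \<in> H m d"
    unfolding H_def by (intro span_add)
  then show ?thesis by simp
qed

lemma move_in_H:
  "length (u @ a # v @ z) \<le> m \<Longrightarrow> wt (u @ a # v @ z) - int e \<le> d \<Longrightarrow>
    W (u @ a # v @ z) - W (u @ v @ a # z) \<in> H m d"
proof (induction v arbitrary: u)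
  case Nil
  then show ?case by (simp add: H_def span_zero)
next
  case (Cons b v)
  have "W (u @ a # b # v @ z) - W (u @ b # a # v @ z) \<in> H m d"
    by (rule bracket_in_H) (use Cons.prems in auto)
  moreover have "W ((u @ [b]) @ a # v @ z) - W ((u @ [b]) @ v @ a # z) \<in> H m d"
    by (rule Cons.IH) (use Cons.prems in auto)
  ultimately have "(W (u @ a # b # v @ z) - W (u @ b # a # v @ z)) + (W ((u @ [b]) @ a # v @ z) - W ((u @ [b]) @ v @ a # z)) \<in> H m d"
    unfolding H_def by (rule span_add)
  then show ?case by simp
qed

lemma negative_weight_letter: "wt w < 0 \<Longrightarrow> \<exists>u a v. w = u @ a # v \<and> a > e + 1"
proof (induction w)
  case (Cons b w)
  show ?case
  proof (cases "b > e + 1")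
    case True
    then show ?thesis by (metis append_Nil)
  next
    case False
    then have "wt w < 0" using Cons.prems by simp
    then obtain u a v where "w = u @ a # v" "a > e + 1" using Cons.IH by blast
    then show ?thesis by (metis append_Cons)
  qed
qed simp

lemma W_snoc_above: "a > e + 1 \<Longrightarrow> W (u @ [a]) \<in> K"
  using W_snoc[of a u] N_le \<Phi>_above[of a] by simp

text \<open>Some letter exceeds \<open>e + 1\<close>. Moved to the right end it kills the generator,
  and the error terms are shorter words whose weight is still negative.\<close>

lemma W_negative_weight: "wt w < 0 \<Longrightarrow> W w \<in> K"
proof (induction "length w" arbitrary: w rule: less_induct)
  case less
  obtain u a v where w: "w = u @ a # v" "a > e + 1" using negative_weight_letter less.prems by blast
  have "W (u @ a # v @ []) - W (u @ v @ a # []) \<in> H (length w) (wt w)"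
    by (rule move_in_H) (use w in auto)
  moreover have "H (length w) (wt w) \<subseteq> K"
    unfolding H_def by (rule span_minimal) (use less subspace_K in auto)
  ultimately have "W w - W ((u @ v) @ [a]) \<in> K" using w by auto
  from K_add[OF this W_snoc_above[OF w(2), of "u @ v"]] show ?case by simp
qed

lemma G_negative: "d < 0 \<Longrightarrow> x \<in> G d \<Longrightarrow> x \<in> K"
  using span_minimal[of "K \<union> W ` {w. wt w \<le> d}" K] subspace_K W_negative_weight
  unfolding G_def by fastforce

text \<open>The letter alone would shift the weight by \<open>e + 1 - a\<close>. Once its scalar on
  the generator is subtracted, only the brackets met on the way to the right end remain, and these
  cost a further \<open>e\<close>.\<close>

lemma lower_in_G:
  assumes "a \<ge> N" "x \<in> G d" "d + 1 - int a \<le> d'"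
  shows "X a x - \<Phi> a *s x \<in> G d'"
proof -
  have W: "X a (W u) - \<Phi> a *s W u \<in> G (wt u + 1 - int a)" for u
  proof (induction u)
    case Nil
    then show ?case using X_v0 assms(1) by (intro K_in_G) simp
  next
    case (Cons c u)
    have "X c (X a (W u) - \<Phi> a *s W u) \<in> G (wt (c # u) + 1 - int a)"
      by (rule G_shift[OF Cons]) simp
    moreover have "W ([] @ a # c # u) - W ([] @ c # a # u) \<in> G (wt (c # u) + 1 - int a)"
      by (rule H_subset_G[OF bracket_in_H]) auto
    ultimately have "(W ([] @ a # c # u) - W ([] @ c # a # u)) + X c (X a (W u) - \<Phi> a *s W u) \<in> G (wt (c # u) + 1 - int a)"
      by (intro G_add)
    then show ?case by (simp add: W_Cons X_linear)
  qed
  show ?thesis using assms(2) unfolding G_def[of d]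
  proof (induction rule: span_induct_alt)
    case base
    then show ?case by (simp add: K_in_G)
  next
    case (step c y x)
    have "X a y - \<Phi> a *s y \<in> G d'"
      using step(1)
    proof
      assume "y \<in> K"
      then show ?thesis by (intro K_in_G K_diff X_in_K K_scale)
    next
      assume "y \<in> W ` {w. wt w \<le> d}"
      then obtain w where "y = W w" "wt w \<le> d" by blast
      then show ?thesis using G_mono[OF _ W[of w]] assms(3) by simp
    qed
    then have "c *s (X a y - \<Phi> a *s y) + (X a x - \<Phi> a *s x) \<in> G d'"
      using step(2) by (intro G_add G_scale)
    then show ?case by (simp add: X_linear scale_right_distrib scale_right_diff_distrib scale_left_commute algebra_simps)
  qed
qed

lemma wt_mset: "mset u = mset v \<Longrightarrow> wt u = wt v"
proof -
  have "wt w = (\<Sum>a\<in>#mset w. int e + 1 - int a)" for w by (induction w) auto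
  then show "mset u = mset v \<Longrightarrow> wt u = wt v" by simp
qed

lemma perm_in_G: "mset u = mset v \<Longrightarrow> W u - W v \<in> G (wt u - int e)"
proof (induction u arbitrary: v)
  case Nil
  then show ?case by (simp add: K_in_G)
next
  case (Cons a u)
  then have "a \<in> set v" by (metis list.set_intros(1) mset_eq_setD)
  then obtain p q where v: "v = p @ a # q" by (meson split_list)
  have w: "wt v = wt (a # u)" using Cons.prems by (metis wt_mset)
  have "mset u = mset (p @ q)" using Cons.prems v by simp
  then have "W u - W (p @ q) \<in> G (wt u - int e)" by (rule Cons.IH)
  then have "X a (W u - W (p @ q)) \<in> G (wt (a # u) - int e)" by (rule G_shift) simp
  moreover have "W ([] @ a # p @ q) - W ([] @ p @ a # q) \<in> G (wt (a # u) - int e)"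
    by (rule H_subset_G[OF move_in_H]) (use w v in auto)
  ultimately have "X a (W u - W (p @ q)) + (W ([] @ a # p @ q) - W ([] @ p @ a # q)) \<in> G (wt (a # u) - int e)"
    by (rule G_add)
  then show ?case by (simp add: v W_Cons X_linear)
qed

end

section \<open>Lowering operators\<close>

lemma mset_Cons_remove1: "b \<in> set t \<Longrightarrow> mset (b # remove1 b t) = mset t"
  by simp

text \<open>The setting for \<open>n \<ge> 1\<close>: with \<open>N = n + 1\<close>, both candidates
  \<open>2 * n - 1\<close> and \<open>2 * n\<close> for \<open>e\<close> satisfy
  \<open>e_ge\<close>. The bound puts \<open>e + 2 - b\<close> among the letters
  \<open>\<ge> N\<close> whenever \<open>b < N\<close>.\<close>

locale generic_module = filtered_word_module scale X C K v0 \<Phi> N e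
  for scale :: "'k::field_char_0 \<Rightarrow> 'v::ab_group_add \<Rightarrow> 'v" (infixr \<open>*s\<close> 75)
    and X C K v0 \<Phi> N e +
  assumes \<Phi>_e: "\<Phi> (e + 1) \<noteq> 0" and N_ge: "N \<ge> 2" and e_ge: "e + 3 \<ge> 2 * N"
begin

text \<open>At the right end \<open>p\<close> becomes the scalar \<open>\<Phi> p\<close>. For
  \<open>p < e + 1\<close> a letter of positive weight is lost, for \<open>p > e + 1\<close> the
  scalar is zero, and the move itself costs \<open>e \<ge> 1\<close>.\<close>

lemma upper_letter_in_G:
  assumes "p \<ge> N" "p \<noteq> e + 1"
  shows "W (p # t) \<in> G (wt (p # t) - 1)"
proof -
  have "W ([] @ p # t @ []) - W ([] @ t @ p # []) \<in> G (wt (p # t) - 1)"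
    by (rule H_subset_G[OF move_in_H]) (use e_ge N_ge in auto)
  moreover have "W (t @ [p]) \<in> G (wt (p # t) - 1)"
  proof (cases "p > e + 1")
    case True
    then show ?thesis by (simp add: W_snoc_above K_in_G)
  next
    case False
    then have "\<Phi> p *s W t \<in> G (wt (p # t) - 1)" using assms(2) by (intro G_scale W_in_G) simp
    from G_add[OF K_in_G[OF W_snoc[OF assms(1), of t]] this] show ?thesis by simp
  qed
  ultimately have "(W ([] @ p # t @ []) - W ([] @ t @ p # [])) + W (t @ [p]) \<in> G (wt (p # t) - 1)"
    by (rule G_add)
  then show ?thesis by simp
qed

lemma critical_letter_in_G: "W ((e + 1) # t) - \<Phi> (e + 1) *s W t \<in> G (wt t - 1)"
proof -
  have "W ([] @ (e + 1) # t @ []) - W ([] @ t @ (e + 1) # []) \<in> G (wt t - 1)"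
    by (rule H_subset_G[OF move_in_H]) (use e_ge N_ge in auto)
  from G_add[OF this K_in_G[OF W_snoc[OF N_le, of t]]] show ?thesis by simp
qed

text \<open>The scalar by which the bracket of the letters \<open>e + 2 - b\<close> and
  \<open>b\<close> acts in leading weight: its term with letter \<open>e + 3\<close> has lower
  weight, and the letter \<open>e + 1\<close> has weight zero and acts as
  \<open>\<Phi> (e + 1)\<close>.\<close>

definition \<gamma> :: "nat \<Rightarrow> 'k" where
  "\<gamma> b = - 4 * (of_nat (e + 2 - b) - of_nat b) * \<Phi> (e + 1)"

lemma \<gamma>_nonzero: assumes "b < N" shows "\<gamma> b \<noteq> 0"
proof -
  have "e + 2 - b \<noteq> b" using assms e_ge by simp
  then have "of_nat (e + 2 - b) \<noteq> (of_nat b :: 'k)" by (simp only: of_nat_eq_iff not_False_eq_True)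
  then show ?thesis using \<Phi>_e by (simp add: \<gamma>_def)
qed

definition T :: "nat \<Rightarrow> 'v \<Rightarrow> 'v" where
  "T b x = X (e + 2 - b) x - \<Phi> (e + 2 - b) *s x"

lemma T_linear: "T b (x + y) = T b x + T b y" "T b (x - y) = T b x - T b y" "T b (c *s x) = c *s T b x"
  by (simp_all add: T_def X_linear scale_right_distrib scale_right_diff_distrib scale_left_commute algebra_simps)

lemma T_in_G:
  assumes "b < N" "x \<in> G d" "d - (int e + 1 - int b) \<le> d'"
  shows "T b x \<in> G d'"
  unfolding T_def by (rule lower_in_G[OF _ assms(2)]) (use assms e_ge in auto)

text \<open>Modulo lower weight, \<open>T b\<close> is the derivation \<open>\<gamma> b * d/dX\<^sub>b\<close>. The exception is the letter \<open>N - 1\<close>,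
  whose derivation can also turn a letter \<open>0\<close> into \<open>N - 1\<close>.\<close>

lemma T_word:
  assumes "b < N"
  shows "set u \<subseteq> {..<N} \<Longrightarrow> b \<noteq> N - 1 \<or> 0 \<notin> set u \<Longrightarrow>
    T b (W u) - (\<gamma> b * of_nat (count_list u b)) *s W (remove1 b u) \<in> G (wt u - (int e + 1 - int b) - 1)"
proof (induction u)
  case Nil
  have "e + 2 - b \<ge> N" using assms e_ge by simp
  then show ?case using X_v0 by (simp add: T_def K_in_G)
next
  case (Cons c u)
  define a where "a = e + 2 - b"
  define D where "D = wt (c # u) - (int e + 1 - int b) - 1"
  have a: "a \<ge> N" "int a = int e + 2 - int b" using assms e_ge by (auto simp: a_def)
  have c: "c < N" using Cons.prems by simp
  let ?m = "of_nat (count_list u b) :: 'k"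
  \<comment> \<open>Leibniz rule: \<open>1\<close> lets \<open>T b\<close> act on \<open>u\<close>,
    and \<open>2\<close> isolates the bracket with the first letter. Of its two terms only the one
    with letter \<open>a + c - 1\<close> can contribute above weight \<open>D\<close>, and only if
    that letter is \<open>e + 1\<close>, that is, if \<open>c = b\<close>.\<close>
  have "X c (T b (W u) - (\<gamma> b * ?m) *s W (remove1 b u)) \<in> G D"
    by (rule G_shift[OF Cons.IH]) (use Cons.prems in \<open>auto simp: D_def\<close>)
  then have 1: "X c (X a (W u)) - \<Phi> a *s W (c # u) - (\<gamma> b * ?m) *s W (c # remove1 b u) \<in> G D"
    by (simp add: T_def a_def X_linear W_Cons)
  have 2: "W (a # c # u) - W (c # a # u) - (of_nat a - of_nat c) *s (W ((a + c + 1) # u) - 4 *s W ((a + c - 1) # u)) \<in> G D"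
    using K_in_G[OF W_swap[of "[]" a c u]] by simp
  have 3: "W ((a + c + 1) # u) \<in> G D"
    by (rule W_in_G) (use a c in \<open>simp add: D_def\<close>)
  \<comment> \<open>The origin of the exception: for \<open>c = 0\<close> and
    \<open>b = N - 1\<close> the letter is \<open>e + 2 - N\<close>, which is \<open>N - 1\<close>
    when \<open>e + 3 = 2 * N\<close>, so that \<open>\<Phi>\<close> gives no scalar for it.\<close>
  have p: "a + c - 1 \<ge> N"
  proof (cases "c = 0")
    case True
    then have "b \<noteq> N - 1" using Cons.prems by simp
    then have "b < N - 1" using assms by simp
    then show ?thesis using e_ge by (simp add: a_def)
  qed (use a in simp)
  have ac: "int (a + c - 1) = int a + int c - 1" using a N_ge by simp
  have 4: "W ((a + c - 1) # u) - (if c = b then \<Phi> (e + 1) else 0) *s W u \<in> G D"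
  proof (cases "c = b")
    case True
    then have "a + c - 1 = e + 1" using assms e_ge by (simp add: a_def)
    then show ?thesis using critical_letter_in_G[of u] True by (simp add: D_def)
  next
    case False
    then have "a + c - 1 \<noteq> e + 1" using assms e_ge by (simp add: a_def)
    from upper_letter_in_G[OF p this, of u] show ?thesis
      using False ac a by (simp add: D_def add.commute diff_diff_eq add_diff_eq algebra_simps)
  qed
  \<comment> \<open>If \<open>c = b\<close> occurs in \<open>u\<close>, then
    \<open>b # remove1 b u\<close> is a rearrangement of \<open>u\<close> and agrees with it in
    leading weight, so the multiplicity grows by one.\<close>
  have 5: "(\<gamma> b * ?m) *s W (c # remove1 b u) + (if c = b then \<gamma> b else 0) *s W u
      - (\<gamma> b * of_nat (count_list (c # u) b)) *s W (remove1 b (c # u)) \<in> G D"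
  proof (cases "c = b")
    case False
    then show ?thesis by (simp add: K_in_G)
  next
    case True
    show ?thesis
    proof (cases "b \<in> set u")
      case True
      have "W (b # remove1 b u) - W u \<in> G (wt (b # remove1 b u) - int e)"
        by (rule perm_in_G[OF mset_Cons_remove1[OF True]])
      moreover have "wt (b # remove1 b u) = wt u" by (rule wt_mset[OF mset_Cons_remove1[OF True]])
      ultimately have "W (b # remove1 b u) - W u \<in> G D"
        using \<open>c = b\<close> e_ge N_ge by (auto simp: D_def elim!: G_mono[rotated])
      from G_scale[OF this, of "\<gamma> b * ?m"] show ?thesis
        using \<open>c = b\<close> by (simp add: scale_right_diff_distrib scale_left_distrib algebra_simps)
    next
      case False
      then show ?thesis using \<open>c = b\<close> by (simp add: K_in_G count_list_0_iff)
    qed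
  qed
  have 7: "(of_nat a - of_nat c) *s 4 *s (if c = b then \<Phi> (e + 1) else 0) *s W u = - (if c = b then \<gamma> b else 0) *s W u"
  proof -
    have "(of_nat a - of_nat c) * (4 * (if c = b then \<Phi> (e + 1) else 0)) = - (if c = b then \<gamma> b else 0)"
      by (cases "c = b") (simp_all add: \<gamma>_def a_def algebra_simps)
    then show ?thesis by (simp only: scale_scale mult.assoc)
  qed
  have 6: "(of_nat a - of_nat c) *s (W ((a + c + 1) # u) - 4 *s W ((a + c - 1) # u)) - (if c = b then \<gamma> b else 0) *s W u \<in> G D"
  proof -
    let ?q = "if c = b then \<Phi> (e + 1) else 0"
    have "(of_nat a - of_nat c) *s (W ((a + c + 1) # u) - 4 *s (W ((a + c - 1) # u) - ?q *s W u)) \<in> G D"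
      by (intro G_scale G_diff 3 4)
    moreover have "W ((a + c + 1) # u) - 4 *s (W ((a + c - 1) # u) - ?q *s W u)
        = (W ((a + c + 1) # u) - 4 *s W ((a + c - 1) # u)) + 4 *s ?q *s W u"
      by (simp only: scale_right_diff_distrib diff_diff_eq2 diff_add_eq)
    ultimately show ?thesis
      by (simp only: scale_right_distrib 7 scale_minus_left add_uminus_conv_diff)
  qed
  have telescope: "p - f - z = (q - f - m) + (p - q - y) + (y - g) + (m + g - z)" for p q f z m y g :: 'v
    by simp
  have "T b (W (c # u)) = W (a # c # u) - \<Phi> a *s W (c # u)" "X c (X a (W u)) = W (c # a # u)"
    by (simp_all add: T_def a_def W_Cons)
  then show ?case
    using G_add[OF G_add[OF G_add[OF 1 2] 6] 5]
    by (simp only: D_def[symmetric] telescope[symmetric])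
qed

definition Ts :: "nat list \<Rightarrow> 'v \<Rightarrow> 'v" where "Ts \<beta> = foldr T \<beta>"

lemma Ts_simps [simp]: "Ts [] x = x" "Ts (b # \<beta>) x = T b (Ts \<beta> x)" "Ts (\<alpha> @ \<beta>) x = Ts \<alpha> (Ts \<beta> x)"
  by (simp_all add: Ts_def)

lemma Ts_linear: "Ts \<beta> (x + y) = Ts \<beta> x + Ts \<beta> y" "Ts \<beta> (x - y) = Ts \<beta> x - Ts \<beta> y" "Ts \<beta> (c *s x) = c *s Ts \<beta> x"
  by (induction \<beta>) (simp_all add: T_linear)

lemma Ts_sum: "Ts \<beta> (\<Sum>w\<in>F. f w) = (\<Sum>w\<in>F. Ts \<beta> (f w))"
proof -
  have "Ts \<beta> 0 = 0" using Ts_linear(3)[of \<beta> 0 0] by simp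
  then show ?thesis by (induction F rule: infinite_finite_induct) (simp_all add: Ts_linear)
qed

lemma Ts_in_G: "set \<beta> \<subseteq> {..<N} \<Longrightarrow> x \<in> G d \<Longrightarrow> d - wt \<beta> \<le> d' \<Longrightarrow> Ts \<beta> x \<in> G d'"
proof (induction \<beta> arbitrary: d')
  case Nil
  then show ?case using G_mono by simp
next
  case (Cons b \<beta>)
  then have "Ts \<beta> x \<in> G (d - wt \<beta>)" by simp
  then show ?case using Cons.prems by (auto intro: T_in_G)
qed

text \<open>Iterated derivatives of a monomial. \<open>\<rho>\<close> is what is left of
  \<open>\<nu>\<close> after removing \<open>\<beta>\<close>, and \<open>\<kappa>\<close> collects
  the scalars \<open>\<gamma> b\<close> with multiplicities, so it vanishes exactly when
  \<open>\<beta>\<close> does not divide \<open>\<nu>\<close>.\<close>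

lemma Ts_word:
  assumes "set \<nu> \<subseteq> {..<N}"
  shows "set \<beta> \<subseteq> {..<N} \<Longrightarrow> N - 1 \<notin> set \<beta> \<or> 0 \<notin> set \<nu> \<Longrightarrow>
    \<exists>\<kappa> \<rho>. Ts \<beta> (W \<nu>) - \<kappa> *s W \<rho> \<in> G (wt \<nu> - wt \<beta> - 1) \<and>
      (mset \<beta> \<subseteq># mset \<nu> \<longrightarrow> \<kappa> \<noteq> 0) \<and> (\<kappa> \<noteq> 0 \<longrightarrow> mset \<nu> = mset \<beta> + mset \<rho>)"
proof (induction \<beta>)
  case Nil
  show ?case by (rule exI[of _ 1], rule exI[of _ \<nu>]) (simp add: K_in_G)
next
  case (Cons b \<beta>)
  then obtain \<kappa> \<rho> where *: "Ts \<beta> (W \<nu>) - \<kappa> *s W \<rho> \<in> G (wt \<nu> - wt \<beta> - 1)"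
    "mset \<beta> \<subseteq># mset \<nu> \<Longrightarrow> \<kappa> \<noteq> 0" "\<kappa> \<noteq> 0 \<Longrightarrow> mset \<nu> = mset \<beta> + mset \<rho>" by auto
  have b: "b < N" using Cons.prems by simp
  have t: "T b (Ts \<beta> (W \<nu>) - \<kappa> *s W \<rho>) \<in> G (wt \<nu> - wt (b # \<beta>) - 1)"
    by (rule T_in_G[OF b *(1)]) simp
  show ?case
  proof (cases "\<kappa> = 0")
    case True
    have "mset \<beta> \<subseteq># mset (b # \<beta>)" by simp
    then have "\<not> mset (b # \<beta>) \<subseteq># mset \<nu>" using True *(2) by (meson subset_mset.order_trans)
    then show ?thesis using t True by (intro exI[of _ 0]) auto
  next
    case False
    then have m: "mset \<nu> = mset \<beta> + mset \<rho>" by (rule *(3))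
    then have w: "wt \<nu> = wt \<beta> + wt \<rho>" using wt_mset[of \<nu> "\<beta> @ \<rho>"] by simp
    have "set \<nu> = set \<beta> \<union> set \<rho>" using m by (metis set_mset_mset set_mset_union)
    then have "T b (W \<rho>) - (\<gamma> b * of_nat (count_list \<rho> b)) *s W (remove1 b \<rho>) \<in> G (wt \<rho> - (int e + 1 - int b) - 1)"
      using assms Cons.prems by (intro T_word[OF b]) auto
    moreover have "wt \<rho> - (int e + 1 - int b) - 1 = wt \<nu> - wt (b # \<beta>) - 1" using w by simp
    ultimately have "T b (Ts \<beta> (W \<nu>) - \<kappa> *s W \<rho>)
        + \<kappa> *s (T b (W \<rho>) - (\<gamma> b * of_nat (count_list \<rho> b)) *s W (remove1 b \<rho>)) \<in> G (wt \<nu> - wt (b # \<beta>) - 1)"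
      using t by (intro G_add G_scale) simp_all
    then have "T b (Ts \<beta> (W \<nu>)) - (\<kappa> * (\<gamma> b * of_nat (count_list \<rho> b))) *s W (remove1 b \<rho>) \<in> G (wt \<nu> - wt (b # \<beta>) - 1)"
      by (simp only: T_linear scale_right_diff_distrib scale_scale) simp
    moreover have "b \<in> set \<rho>" if "mset (b # \<beta>) \<subseteq># mset \<nu>"
    proof -
      have "mset \<beta> + {#b#} \<subseteq># mset \<beta> + mset \<rho>" using that m by simp
      then have "{#b#} \<subseteq># mset \<rho>" by (simp only: subset_mset.add_le_cancel_left)
      then show ?thesis by simp
    qed
    moreover have "mset \<nu> = mset (b # \<beta>) + mset (remove1 b \<rho>)" if "b \<in> set \<rho>"
      using that m by simp
    moreover have "\<kappa> * (\<gamma> b * of_nat (count_list \<rho> b)) \<noteq> 0 \<longleftrightarrow> b \<in> set \<rho>"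
      using False \<gamma>_nonzero[OF b] by (simp add: count_list_0_iff)
    ultimately show ?thesis unfolding Ts_simps(2) by blast
  qed
qed

lemma Ts_stable:
  assumes "subspace S" "\<And>a x. x \<in> S \<Longrightarrow> X a x \<in> S" "x \<in> S"
  shows "Ts \<beta> x \<in> S"
proof (induction \<beta>)
  case (Cons b \<beta>)
  then show ?case unfolding Ts_simps T_def by (intro subspace_diff subspace_scale assms(1,2))
qed (simp add: assms(3))

text \<open>A leading word \<open>\<mu>\<close> is differentiated away: first its letters other than
  \<open>N - 1\<close>, then the letters \<open>N - 1\<close>. The order matters, since
  \<open>T (N - 1)\<close> is under control only on words without \<open>0\<close>, and the first
  stage removes the zeros of \<open>\<mu>\<close>.\<close>

theorem v0_in_submodule:
  assumes S: "subspace S" "K \<subseteq> S" "\<And>a x. x \<in> S \<Longrightarrow> X a x \<in> S"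
    and x: "x \<in> S" "x \<in> C" "x \<notin> K"
  shows "v0 \<in> S"
proof -
  define low where "low = filter (\<lambda>a. a \<noteq> N - 1)"
  obtain F c where F: "finite F" "F \<subseteq> {w. sorted w \<and> set w \<subseteq> {..<N}}" "\<forall>w\<in>F. c w \<noteq> 0"
    and xF: "x - (\<Sum>w\<in>F. c w *s W w) \<in> K"
    using combination_of_words[OF subsetD[OF C_subset_span_sorted x(2)]] by blast
  have "F \<noteq> {}" using xF x(3) by auto
  define m where "m = Max (wt ` F)"
  define F' where "F' = {w\<in>F. wt w = m}"
  have F': "finite F'" "F' \<noteq> {}"
  proof -
    have "m \<in> wt ` F" unfolding m_def using F(1) \<open>F \<noteq> {}\<close> by (intro Max_in) auto
    then show "finite F'" "F' \<noteq> {}" using F(1) by (auto simp: F'_def)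
  qed
  \<comment> \<open>Among the words of top weight, \<open>\<mu>\<close> gets the most letters other
    than \<open>N - 1\<close>; then no other word of top weight in \<open>F\<close> is divisible by
    \<open>low \<mu>\<close>.\<close>
  define l where "l = Max ((\<lambda>w. length (low w)) ` F')"
  have "l \<in> (\<lambda>w. length (low w)) ` F'" unfolding l_def using F' by (intro Max_in) auto
  then obtain \<mu> where \<mu>: "\<mu> \<in> F'" "length (low \<mu>) = l" by blast
  have wt_max: "wt w \<le> m" if "w \<in> F" for w using that F(1) by (auto simp: m_def)
  have low_max: "length (low w) \<le> l" if "w \<in> F'" for w using that F'(1) by (auto simp: l_def)
  define \<beta> where "\<beta> = replicate (count_list \<mu> (N - 1)) (N - 1)"
  have mset_split: "mset w = mset (low w) + mset (replicate (count_list w (N - 1)) (N - 1))" for w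
    by (induction w) (auto simp: low_def)
  have wt_split: "wt w = wt (low w) + int (count_list w (N - 1)) * (int e + 1 - int (N - 1))" for w
    by (induction w) (auto simp: low_def algebra_simps)
  have \<mu>F: "sorted \<mu>" "set \<mu> \<subseteq> {..<N}" "wt \<mu> = m" using \<mu> F by (auto simp: F'_def)
  have low: "set (low \<mu>) \<subseteq> {..<N}" "N - 1 \<notin> set (low \<mu>)" using \<mu>F by (auto simp: low_def)
  have \<beta>: "set \<beta> \<subseteq> {..<N}" "0 \<notin> set \<beta>" "wt \<mu> = wt (low \<mu>) + wt \<beta>" "mset \<mu> = mset (low \<mu>) + mset \<beta>"
  proof -
    show "set \<beta> \<subseteq> {..<N}" "0 \<notin> set \<beta>" using N_ge by (auto simp: \<beta>_def)
    show "mset \<mu> = mset (low \<mu>) + mset \<beta>" unfolding \<beta>_def by (rule mset_split)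
    then show "wt \<mu> = wt (low \<mu>) + wt \<beta>" using wt_mset[of \<mu> "low \<mu> @ \<beta>"] by simp
  qed
  have others: "Ts (\<beta> @ low \<mu>) (W \<nu>) \<in> K" if \<nu>: "\<nu> \<in> F" "\<nu> \<noteq> \<mu>" for \<nu>
  proof (cases "wt \<nu> = m")
    case False
    then have "wt \<nu> < m" using wt_max \<nu> by fastforce
    then have "Ts (\<beta> @ low \<mu>) (W \<nu>) \<in> G (-1)"
      by (intro Ts_in_G[OF _ W_in_G[OF order_refl]]) (use \<beta> low \<mu>F in auto)
    then show ?thesis by (rule G_negative[rotated]) simp
  next
    case True
    then have "length (low \<nu>) \<le> l" "set \<nu> \<subseteq> {..<N}" "sorted \<nu>" using low_max \<nu> F by (auto simp: F'_def)
    obtain \<kappa> \<rho> where *: "Ts (low \<mu>) (W \<nu>) - \<kappa> *s W \<rho> \<in> G (wt \<nu> - wt (low \<mu>) - 1)"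
      "\<kappa> \<noteq> 0 \<longrightarrow> mset \<nu> = mset (low \<mu>) + mset \<rho>"
      using Ts_word[OF \<open>set \<nu> \<subseteq> {..<N}\<close> low(1)] low(2) by blast
    \<comment> \<open>Divisibility and maximality give \<open>low \<nu>\<close> and
      \<open>low \<mu>\<close> the same letters. As \<open>N - 1\<close> has positive weight, equal
      weights then give equally many letters \<open>N - 1\<close>, and two sorted words with the
      same letters coincide.\<close>
    have "\<kappa> = 0"
    proof (rule ccontr)
      assume "\<kappa> \<noteq> 0"
      then have "mset \<nu> = mset (low \<mu>) + mset \<rho>" using * by blast
      then have "filter_mset (\<lambda>a. a \<noteq> N - 1) (mset \<nu>) = filter_mset (\<lambda>a. a \<noteq> N - 1) (mset (low \<mu>)) + filter_mset (\<lambda>a. a \<noteq> N - 1) (mset \<rho>)"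
        by simp
      then have ml: "mset (low \<nu>) = mset (low \<mu>) + mset (low \<rho>)" by (simp add: low_def filter_filter_mset)
      then have "length (low \<nu>) = length (low \<mu>) + length (low \<rho>)" by (metis size_mset size_union)
      then have "low \<rho> = []" using \<open>length (low \<nu>) \<le> l\<close> \<mu>(2) by simp
      then have ml: "mset (low \<nu>) = mset (low \<mu>)" using ml by simp
      then have "wt (low \<nu>) = wt (low \<mu>)" by (rule wt_mset)
      moreover have "int e + 1 - int (N - 1) > 0" using N_le N_ge by simp
      ultimately have "count_list \<nu> (N - 1) = count_list \<mu> (N - 1)"
        using wt_split[of \<nu>] wt_split[of \<mu>] True \<mu>F(3) by simp
      then have "mset \<nu> = mset \<mu>" using mset_split[of \<nu>] mset_split[of \<mu>] ml by simp
      then show False using \<open>sorted \<nu>\<close> \<mu>F(1) \<nu>(2) by (metis properties_for_sort sorted_sort_id)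
    qed
    then have "Ts \<beta> (Ts (low \<mu>) (W \<nu>)) \<in> G (-1)"
      using * by (intro Ts_in_G[of \<beta> _ "wt \<nu> - wt (low \<mu>) - 1"]) (use \<beta> True \<mu>F in auto)
    then show ?thesis by (simp add: G_negative[of "-1"])
  qed
  have sub: "mset (low \<mu>) \<subseteq># mset \<mu>" using \<beta>(4) by (metis mset_subset_eq_add_left)
  have "\<exists>\<kappa> \<rho>. Ts (low \<mu>) (W \<mu>) - \<kappa> *s W \<rho> \<in> G (wt \<mu> - wt (low \<mu>) - 1) \<and>
      (mset (low \<mu>) \<subseteq># mset \<mu> \<longrightarrow> \<kappa> \<noteq> 0) \<and> (\<kappa> \<noteq> 0 \<longrightarrow> mset \<mu> = mset (low \<mu>) + mset \<rho>)"
    by (rule Ts_word[OF \<mu>F(2) low(1) disjI1[OF low(2)]])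
  then obtain \<kappa> \<rho> where 1: "Ts (low \<mu>) (W \<mu>) - \<kappa> *s W \<rho> \<in> G (wt \<mu> - wt (low \<mu>) - 1)"
    and \<kappa>: "\<kappa> \<noteq> 0" "mset \<mu> = mset (low \<mu>) + mset \<rho>"
    using sub by blast
  have \<rho>: "mset \<rho> = mset \<beta>" using \<kappa>(2) unfolding \<beta>(4) by (simp only: add_left_cancel)
  then have set_\<rho>: "set \<rho> = set \<beta>" by (rule mset_eq_setD)
  have "\<exists>\<kappa>' \<rho>'. Ts \<beta> (W \<rho>) - \<kappa>' *s W \<rho>' \<in> G (wt \<rho> - wt \<beta> - 1) \<and>
      (mset \<beta> \<subseteq># mset \<rho> \<longrightarrow> \<kappa>' \<noteq> 0) \<and> (\<kappa>' \<noteq> 0 \<longrightarrow> mset \<rho> = mset \<beta> + mset \<rho>')"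
    by (rule Ts_word) (use \<beta>(1,2) set_\<rho> in simp_all)
  then obtain \<kappa>' \<rho>' where 2: "Ts \<beta> (W \<rho>) - \<kappa>' *s W \<rho>' \<in> G (wt \<rho> - wt \<beta> - 1)"
    and \<kappa>': "\<kappa>' \<noteq> 0" "mset \<rho> = mset \<beta> + mset \<rho>'"
    using \<rho> by auto
  have "\<rho>' = []" "wt \<rho> = wt \<beta>" using \<kappa>'(2) \<rho> wt_mset[OF \<rho>] by simp_all
  \<comment> \<open>Altogether the operators lower the weight by that of \<open>\<mu>\<close>, so
    all error terms have negative weight and lie in \<open>K\<close>.\<close>
  then have "Ts \<beta> (W \<rho>) - \<kappa>' *s v0 \<in> G (-1)" using 2 by simp
  moreover have "Ts \<beta> (Ts (low \<mu>) (W \<mu>) - \<kappa> *s W \<rho>) \<in> G (-1)"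
    by (rule Ts_in_G[OF \<beta>(1) 1]) (use \<beta> in simp)
  ultimately have "Ts \<beta> (Ts (low \<mu>) (W \<mu>) - \<kappa> *s W \<rho>) + \<kappa> *s (Ts \<beta> (W \<rho>) - \<kappa>' *s v0) \<in> G (-1)"
    by (intro G_add G_scale)
  then have "Ts (\<beta> @ low \<mu>) (W \<mu>) - (\<kappa> * \<kappa>') *s v0 \<in> G (-1)"
    by (simp add: Ts_linear scale_right_diff_distrib)
  then have \<mu>K: "Ts (\<beta> @ low \<mu>) (W \<mu>) - (\<kappa> * \<kappa>') *s v0 \<in> S"
    using S(2) G_negative[of "-1"] by auto
  have "\<mu> \<in> F" using \<mu> by (simp add: F'_def)
  have "Ts (\<beta> @ low \<mu>) x \<in> S" "Ts (\<beta> @ low \<mu>) (x - (\<Sum>w\<in>F. c w *s W w)) \<in> S"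
    using Ts_stable[OF S(1,3)] x(1) xF S(2) by blast+
  moreover have "(\<Sum>w\<in>F - {\<mu>}. c w *s Ts (\<beta> @ low \<mu>) (W w)) \<in> S"
    by (rule subspace_sum[OF S(1)]) (use others S in \<open>auto intro!: subspace_scale\<close>)
  ultimately have *: "Ts (\<beta> @ low \<mu>) x - Ts (\<beta> @ low \<mu>) (x - (\<Sum>w\<in>F. c w *s W w))
      - (\<Sum>w\<in>F - {\<mu>}. c w *s Ts (\<beta> @ low \<mu>) (W w)) \<in> S"
    using S(1) by (intro subspace_diff)
  have "c \<mu> *s Ts (\<beta> @ low \<mu>) (W \<mu>) \<in> S"
  proof -
    have "Ts (\<beta> @ low \<mu>) (\<Sum>w\<in>F. c w *s W w)
        = c \<mu> *s Ts (\<beta> @ low \<mu>) (W \<mu>) + (\<Sum>w\<in>F - {\<mu>}. c w *s Ts (\<beta> @ low \<mu>) (W w))"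
      by (simp only: Ts_sum Ts_linear(1,3) sum.remove[OF F(1) \<open>\<mu> \<in> F\<close>])
    with * show ?thesis by (simp only: Ts_linear(2) diff_diff_eq2 add_diff_cancel_left' add_diff_cancel_right')
  qed
  from subspace_diff[OF S(1) this subspace_scale[OF S(1) \<mu>K, of "c \<mu>"]]
  have "(c \<mu> * (\<kappa> * \<kappa>')) *s v0 \<in> S"
    by (simp only: scale_right_diff_distrib scale_scale diff_diff_eq2 add_diff_cancel_left')
  moreover have "c \<mu> * (\<kappa> * \<kappa>') \<noteq> 0" using \<kappa>(1) \<kappa>'(1) F(3) \<open>\<mu> \<in> F\<close> by simp
  ultimately show ?thesis by (rule subspace_scale_cancel[OF S(1)])
qed

end

section \<open>The case $n = 0$\<close>

text \<open>The only letter below \<open>N\<close> is \<open>0\<close>, of weight 1, so modulo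
  \<open>K\<close> the powers of \<open>X 0\<close> applied to \<open>v0\<close> span. As
  \<open>e = 0\<close>, a bracket need not lower the weight, which rules out the argument by
  derivations.\<close>

locale rank_one_module = filtered_word_module scale X C K v0 \<Phi> 1 0
  for scale :: "'k::field_char_0 \<Rightarrow> 'v::ab_group_add \<Rightarrow> 'v" (infixr \<open>*s\<close> 75)
    and X C K v0 \<Phi> +
  assumes \<Phi>_1: "\<Phi> 1 \<noteq> 0"
begin

definition V :: "nat \<Rightarrow> 'v" where "V k = W (replicate k 0)"

lemma V_0: "V 0 = v0" by (simp add: V_def)
lemma X_V: "X 0 (V k) = V (Suc k)" by (simp add: V_def W_Cons)

lemma V_in_G: "int k \<le> d \<Longrightarrow> V k \<in> G d"
  unfolding V_def by (rule W_in_G) (simp add: wt_def sum_list_replicate)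

lemma V_comm: "X a (V (Suc k)) - X 0 (X a (V k)) - of_nat a *s (X (a + 1) (V k) - 4 *s X (a - 1) (V k)) \<in> K"
  using X_comm[OF W_in_C, of a 0 "replicate k 0"] by (simp add: V_def W_Cons)

lemma upper_in_G: "a > 1 \<Longrightarrow> x \<in> G d \<Longrightarrow> X a x \<in> G (d + 1 - int a)"
  using lower_in_G[of a x d "d + 1 - int a"] \<Phi>_above[of a] by simp

text \<open>Each \<open>0\<close> that the letter \<open>1\<close> passes contributes
  \<open>- 4\<close> through the bracket \<open>X 2 - 4 *s X 0\<close>; the term with
  \<open>X 2\<close> has lower weight.\<close>

lemma X1_V: "X 1 (V k) - (\<Phi> 1 - 4 * of_nat k) *s V k \<in> G (int k - 1)"
proof (induction k)
  case 0
  then show ?case using X_v0[of 1] by (simp add: V_0 K_in_G)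
next
  case (Suc k)
  let ?p = "\<Phi> 1 - 4 * of_nat k"
  have telescope: "(a - ?p *s v) + (b - a - (y - 4 *s v)) + y = b - (?p - 4) *s v" for a b y v :: 'v
    by (simp only: scale_left_diff_distrib) simp
  have 1: "X 0 (X 1 (V k)) - ?p *s V (Suc k) \<in> G (int k)"
    using G_shift[OF Suc, of 0 "int k"] by (simp only: X_linear X_V)
  have 2: "X 1 (V (Suc k)) - X 0 (X 1 (V k)) - (X 2 (V k) - 4 *s V (Suc k)) \<in> G (int k)"
    using V_comm[of 1 k] by (intro K_in_G) (simp add: numeral_2_eq_2 X_V)
  have 3: "X 2 (V k) \<in> G (int k)"
    by (rule G_mono[OF _ upper_in_G[OF _ V_in_G[OF order_refl]]]) auto
  have "\<Phi> 1 - 4 * of_nat (Suc k) = ?p - 4" by simp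
  then show ?case using G_add[OF G_add[OF 1 2] 3] by (simp only: telescope) simp
qed

text \<open>The bracket with \<open>0\<close> is \<open>2 *s (X 3 - 4 *s X 1)\<close>, so the
  coefficient is \<open>- 8\<close> times the sum of those in \<open>X1_V\<close> for
  \<open>0\<close> up to \<open>k\<close>.\<close>

lemma X2_V: "X 2 (V (Suc k)) - (- 8 * of_nat (Suc k) * (\<Phi> 1 - 2 * of_nat k)) *s V k \<in> G (int k - 1)"
proof -
  have telescope: "(a - p *s v) + (b - a - 2 *s (y - 4 *s z)) + 2 *s y - 8 *s (z - q *s v) = b - (p - 8 * q) *s v"
    for a b y z v :: 'v and p q by (simp add: scale_right_diff_distrib scale_left_diff_distrib)
  show ?thesis
  proof (induction k)
    case 0
    have 1: "X 0 (X 2 (V 0)) - 0 *s V 0 \<in> G (-1)"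
      using X_in_K X_v0[of 2] \<Phi>_above[of 2] by (intro K_in_G) (simp add: V_0)
    have 2: "X 2 (V 1) - X 0 (X 2 (V 0)) - 2 *s (X 3 (V 0) - 4 *s X 1 (V 0)) \<in> G (-1)"
      using V_comm[of 2 0] by (intro K_in_G) (simp add: numeral_3_eq_3)
    have 3: "X 3 (V 0) \<in> G (-1)" using X_v0[of 3] \<Phi>_above[of 3] by (intro K_in_G) (simp add: V_0)
    have 4: "X 1 (V 0) - \<Phi> 1 *s V 0 \<in> G (-1)" using X1_V[of 0] by simp
    show ?case using G_diff[OF G_add[OF G_add[OF 1 2] G_scale[OF 3, of 2]] G_scale[OF 4, of 8]]
      by (simp only: telescope) simp
  next
    case (Suc k)
    let ?p = "- 8 * of_nat (Suc k) * (\<Phi> 1 - 2 * of_nat k)" and ?q = "\<Phi> 1 - 4 * of_nat (Suc k)"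
    have 1: "X 0 (X 2 (V (Suc k))) - ?p *s V (Suc k) \<in> G (int k)"
      using G_shift[OF Suc, of 0 "int k"] by (simp only: X_linear X_V)
    have 2: "X 2 (V (Suc (Suc k))) - X 0 (X 2 (V (Suc k))) - 2 *s (X 3 (V (Suc k)) - 4 *s X 1 (V (Suc k))) \<in> G (int k)"
      using V_comm[of 2 "Suc k"] by (intro K_in_G) (simp add: numeral_3_eq_3)
    have 3: "X 3 (V (Suc k)) \<in> G (int k)"
      by (rule G_mono[OF _ upper_in_G[OF _ V_in_G[OF order_refl]]]) auto
    have 4: "X 1 (V (Suc k)) - ?q *s V (Suc k) \<in> G (int k)"
      using X1_V[of "Suc k"] by simp
    have "?p - 8 * ?q = - 8 * of_nat (Suc (Suc k)) * (\<Phi> 1 - 2 * of_nat (Suc k))"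
      by (simp add: algebra_simps)
    moreover have "int (Suc k) - 1 = int k" by simp
    ultimately show ?case using G_diff[OF G_add[OF G_add[OF 1 2] G_scale[OF 3, of 2]] G_scale[OF 4, of 8]]
      by (simp only: telescope)
  qed
qed

text \<open>Likewise \<open>- 12\<close> times the sum of the coefficients in \<open>X2_V\<close>
  for \<open>0\<close> up to \<open>k\<close>.\<close>

lemma X3_V: "X 3 (V (Suc (Suc k))) - (16 * of_nat (Suc (Suc k)) * of_nat (Suc k) * (3 * \<Phi> 1 - 4 * of_nat k)) *s V k \<in> G (int k - 1)"
proof -
  have telescope: "(a - p *s v) + (b - a - 3 *s (y - 4 *s z)) + 3 *s y - 12 *s (z - q *s v) = b - (p - 12 * q) *s v"
    for a b y z v :: 'v and p q by (simp add: scale_right_diff_distrib scale_left_diff_distrib)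
  show ?thesis
  proof (induction k)
    case 0
    have 2: "X 3 (V (Suc 1)) - X 0 (X 3 (V 1)) - 3 *s (X 4 (V 1) - 4 *s X 2 (V 1)) \<in> G (-1)"
      using V_comm[of 3 1] by (intro K_in_G) (simp add: numeral_eq_Suc)
    have up: "X 3 (V 1) \<in> G (-1)" and 3: "X 4 (V 1) \<in> G (-1)"
      by (rule G_mono[OF _ upper_in_G[OF _ V_in_G[OF order_refl]]]; simp)+
    have 1: "X 0 (X 3 (V 1)) - 0 *s V 0 \<in> G (-1)"
      using X_in_K G_negative[OF _ up] by (intro K_in_G) simp
    have 4: "X 2 (V 1) - (- 8 * \<Phi> 1) *s V 0 \<in> G (-1)" using X2_V[of 0] by simp
    show ?case using G_diff[OF G_add[OF G_add[OF 1 2] G_scale[OF 3, of 3]] G_scale[OF 4, of 12]]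
      by (simp only: telescope) simp
  next
    case (Suc k)
    let ?p = "16 * of_nat (Suc (Suc k)) * of_nat (Suc k) * (3 * \<Phi> 1 - 4 * of_nat k)"
      and ?q = "- 8 * of_nat (Suc (Suc k)) * (\<Phi> 1 - 2 * of_nat (Suc k))"
    have 1: "X 0 (X 3 (V (Suc (Suc k)))) - ?p *s V (Suc k) \<in> G (int k)"
      using G_shift[OF Suc, of 0 "int k"] by (simp only: X_linear X_V)
    have 2: "X 3 (V (Suc (Suc (Suc k)))) - X 0 (X 3 (V (Suc (Suc k)))) - 3 *s (X 4 (V (Suc (Suc k))) - 4 *s X 2 (V (Suc (Suc k)))) \<in> G (int k)"
      using V_comm[of 3 "Suc (Suc k)"] by (intro K_in_G) (simp add: numeral_eq_Suc)
    have 3: "X 4 (V (Suc (Suc k))) \<in> G (int k)"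
      by (rule G_mono[OF _ upper_in_G[OF _ V_in_G[OF order_refl]]]) auto
    have 4: "X 2 (V (Suc (Suc k))) - ?q *s V (Suc k) \<in> G (int k)"
      using X2_V[of "Suc k"] by simp
    have "?p - 12 * ?q = 16 * of_nat (Suc (Suc (Suc k))) * of_nat (Suc (Suc k)) * (3 * \<Phi> 1 - 4 * of_nat (Suc k))"
      by (simp add: algebra_simps)
    moreover have "int (Suc k) - 1 = int k" by simp
    ultimately show ?case using G_diff[OF G_add[OF G_add[OF 1 2] G_scale[OF 3, of 3]] G_scale[OF 4, of 12]]
      by (simp only: telescope)
  qed
qed

theorem v0_in_submodule:
  assumes S: "subspace S" "K \<subseteq> S" "\<And>a x. x \<in> S \<Longrightarrow> X a x \<in> S"
    and x: "x \<in> S" "x \<in> C" "x \<notin> K"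
  shows "v0 \<in> S"
proof -
  have descent: "v0 \<in> S" if "y \<in> S" "y - c *s V d \<in> G (int d - 1)" "c \<noteq> 0" for y c d
    using that
  proof (induction d arbitrary: y c rule: less_induct)
    case (less d)
    let ?\<alpha> = "\<lambda>k. - 8 * of_nat (Suc k) * (\<Phi> 1 - 2 * of_nat k)"
    consider "d = 0" | k where "d = Suc k" "?\<alpha> k \<noteq> 0" | k where "d = Suc k" "?\<alpha> k = 0" by (cases d) auto
    then show ?case
    proof cases
      case 1
      then have "y - c *s v0 \<in> S" using less.prems(2) S(2) G_negative[of "-1"] by (auto simp: V_0)
      from subspace_diff[OF S(1) less.prems(1) this] have "c *s v0 \<in> S" by simp
      then show ?thesis using less.prems(3) by (rule subspace_scale_cancel[OF S(1)])
    next
      case (2 k)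
      have 1: "X 2 (y - c *s V d) \<in> G (int k - 1)"
        by (rule G_shift[OF less.prems(2)]) (use 2 in simp)
      have "X 2 (y - c *s V d) + c *s (X 2 (V (Suc k)) - ?\<alpha> k *s V k) \<in> G (int k - 1)"
        by (intro G_add G_scale 1 X2_V)
      then have "X 2 y - (c * ?\<alpha> k) *s V k \<in> G (int k - 1)"
        unfolding 2(1) X_linear scale_right_diff_distrib scale_scale by simp
      then show ?thesis using 2 less.prems S(3) by (intro less.IH[of k "X 2 y" "c * ?\<alpha> k"]) auto
    next
      case (3 k)
      \<comment> \<open>If \<open>X 2\<close> fails to lower the leading power, then
        \<open>\<Phi> 1 = 2 * of_nat k\<close> with \<open>k > 0\<close>. For
        \<open>k = m + 1\<close> the last factor in \<open>X3_V\<close> becomes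
        \<open>2 * m + 6\<close>, so \<open>X 3\<close> lowers the power by two instead.\<close>
      then have k: "\<Phi> 1 = 2 * of_nat k" by (simp del: of_nat_Suc)
      then obtain m where m: "k = Suc m" using \<Phi>_1 by (cases k) auto
      let ?\<beta> = "16 * of_nat (Suc (Suc m)) * of_nat (Suc m) * (3 * \<Phi> 1 - 4 * of_nat m)"
      have "3 * \<Phi> 1 - 4 * of_nat m = of_nat (2 * m + 6)" using k m by simp
      also have "\<dots> \<noteq> (0::'k)" by (simp only: of_nat_eq_0_iff)
      finally have \<beta>: "?\<beta> \<noteq> 0" by (simp del: of_nat_Suc)
      have 1: "X 3 (y - c *s V d) \<in> G (int m - 1)"
        by (rule G_shift[OF less.prems(2)]) (use 3 m in simp)
      have "X 3 (y - c *s V d) + c *s (X 3 (V (Suc (Suc m))) - ?\<beta> *s V m) \<in> G (int m - 1)"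
        by (intro G_add G_scale 1 X3_V)
      then have "X 3 y - (c * ?\<beta>) *s V m \<in> G (int m - 1)"
        unfolding 3(1) m X_linear scale_right_diff_distrib scale_scale by simp
      then show ?thesis using 3 m \<beta> less.prems S(3) by (intro less.IH[of m "X 3 y" "c * ?\<beta>"]) auto
    qed
  qed
  obtain F c where F: "finite F" "F \<subseteq> {w. sorted w \<and> set w \<subseteq> {..<1}}" "\<forall>w\<in>F. c w \<noteq> 0"
    and xF: "x - (\<Sum>w\<in>F. c w *s W w) \<in> K"
    using combination_of_words[OF subsetD[OF C_subset_span_sorted x(2)]] by blast
  have "F \<noteq> {}" using xF x(3) by auto
  define d where "d = Max (length ` F)"
  have "d \<in> length ` F" unfolding d_def using F(1) \<open>F \<noteq> {}\<close> by (intro Max_in) auto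
  then obtain u where u: "u \<in> F" "length u = d" by auto
  have rep: "w = replicate (length w) 0" if "w \<in> F" for w
    using that F(2) by (intro replicate_eqI) auto
  have "(\<Sum>w\<in>F - {u}. c w *s W w) \<in> G (int d - 1)"
  proof (rule subspace_sum[OF subspace_G])
    fix w assume w: "w \<in> F - {u}"
    then have "length w \<noteq> d" using rep u by (metis Diff_iff singletonI)
    moreover have "length w \<le> d" using w F(1) by (auto simp: d_def)
    ultimately have "V (length w) \<in> G (int d - 1)" by (intro V_in_G) simp
    then show "c w *s W w \<in> G (int d - 1)" using rep[of w] w by (auto simp: V_def intro!: G_scale)
  qed
  from G_add[OF K_in_G[OF xF] this] have "x - c u *s W u \<in> G (int d - 1)"
    by (simp add: sum.remove[OF F(1) u(1)])
  moreover have "W u = V d" using rep[OF u(1)] u(2) by (simp add: V_def)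
  ultimately show ?thesis using descent[OF x(1)] F(3) u(1) by metis
qed

end

section \<open>Twisting by a character\<close>

context word_module
begin

text \<open>By hypothesis \<open>\<chi>\<close> vanishes on brackets, so it is a character of the
  whole algebra, and shifting the operators by it preserves the relations and the stable
  subspaces.\<close>

lemma twisted_word_module:
  assumes \<chi>: "\<And>a b. a + b \<ge> 1 \<Longrightarrow> \<chi> (a + b + 1) = 4 * \<chi> (a + b - 1)"
  shows "word_module scale (\<lambda>a x. X a x - \<chi> a *s x) C K v0 (\<lambda>a. \<Phi> a - \<chi> a) N"
proof
  fix a b and c :: 'k and x y :: 'v and S :: "'v set"
  show "X a (x + y) - \<chi> a *s (x + y) = X a x - \<chi> a *s x + (X a y - \<chi> a *s y)"
    by (simp add: X_linear scale_right_distrib)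
  show "X a (c *s x) - \<chi> a *s c *s x = c *s (X a x - \<chi> a *s x)"
    by (simp add: X_linear scale_right_diff_distrib mult.commute)
  show "subspace C" "subspace K" "v0 \<in> C" by (fact subspace_C subspace_K v0_in_C)+
  show "x \<in> C \<Longrightarrow> X a x - \<chi> a *s x \<in> C"
    using subspace_C by (intro subspace_diff subspace_scale X_in_C)
  show "x \<in> K \<Longrightarrow> X a x - \<chi> a *s x \<in> K"
    by (intro K_diff K_scale X_in_K)
  show "a \<ge> N \<Longrightarrow> X a v0 - \<chi> a *s v0 - (\<Phi> a - \<chi> a) *s v0 \<in> K"
    using X_v0[of a] by (simp add: scale_left_diff_distrib)
  show "x \<in> C \<Longrightarrow> X a (X b x - \<chi> b *s x) - \<chi> a *s (X b x - \<chi> b *s x)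
      - (X b (X a x - \<chi> a *s x) - \<chi> b *s (X a x - \<chi> a *s x))
      - (of_nat a - of_nat b) *s (X (a + b + 1) x - \<chi> (a + b + 1) *s x - 4 *s (X (a + b - 1) x - \<chi> (a + b - 1) *s x)) \<in> K"
  proof -
    assume x: "x \<in> C"
    have "(of_nat a - of_nat b) *s (X (a + b + 1) x - \<chi> (a + b + 1) *s x - 4 *s (X (a + b - 1) x - \<chi> (a + b - 1) *s x))
        = (of_nat a - of_nat b) *s (X (a + b + 1) x - 4 *s X (a + b - 1) x)"
    proof (cases "a + b \<ge> 1")
      case True
      show ?thesis unfolding \<chi>[OF True] scale_right_diff_distrib scale_scale by simp
    qed simp
    moreover have "X a (X b x - \<chi> b *s x) - \<chi> a *s (X b x - \<chi> b *s x)
      - (X b (X a x - \<chi> a *s x) - \<chi> b *s (X a x - \<chi> a *s x)) = X a (X b x) - X b (X a x)"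
      unfolding X_linear scale_right_diff_distrib scale_scale by (simp add: mult.commute)
    ultimately show ?thesis using X_comm[OF x, of a b] by (simp only:)
  qed
  show "C \<subseteq> S" if S: "subspace S" "v0 \<in> S" and Y: "\<And>a x. x \<in> S \<Longrightarrow> X a x - \<chi> a *s x \<in> S"
  proof (rule C_cyclic[OF S])
    fix a x assume "x \<in> S"
    then have "(X a x - \<chi> a *s x) + \<chi> a *s x \<in> S" using S(1) Y by (intro subspace_add subspace_scale)
    then show "X a x \<in> S" by simp
  qed
qed

theorem v0_in_submodule_of_nondegenerate:
  assumes e: "N \<ge> 2 \<and> e + 3 \<ge> 2 * N \<or> N = 1 \<and> e = 0"
    and \<Phi>: "\<And>a. a \<ge> e + 2 \<Longrightarrow> \<Phi> (a + 2) = 4 * \<Phi> a" "\<Phi> (e + 3) \<noteq> 4 * \<Phi> (e + 1)"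
    and S: "subspace S" "K \<subseteq> S" "\<And>a x. x \<in> S \<Longrightarrow> X a x \<in> S"
    and x: "x \<in> S" "x \<in> C" "x \<notin> K"
  shows "v0 \<in> S"
proof -
  \<comment> \<open>\<open>q a\<close> is whichever of \<open>e + 2\<close> and \<open>e + 3\<close>
    has the parity of \<open>a\<close>. From \<open>e + 2\<close> on, \<open>\<Phi>\<close> is
    multiplied by 4 at every step of two, and \<open>\<chi>\<close> continues this geometric pattern
    to all letters.\<close>
  define q where "q = (\<lambda>a. e + 2 + (a + e) mod 2)"
  define \<chi> where "\<chi> = (\<lambda>a. 2 ^ a * (\<Phi> (q a) / 2 ^ q a))"
  have \<chi>_step: "\<chi> (a + 2) = 4 * \<chi> a" for a
  proof -
    have "q (a + 2) = q a" unfolding q_def by presburger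
    then show ?thesis by (simp add: \<chi>_def)
  qed
  have \<chi>_eq: "\<chi> (e + 2 + m) = \<Phi> (e + 2 + m)" for m
  proof (induction m rule: induct_nat_012)
    case 0
    have "q (e + 2 + 0) = e + 2 + 0" unfolding q_def by presburger
    then show ?case by (simp add: \<chi>_def)
  next
    case 1
    have "q (e + 2 + Suc 0) = e + 2 + Suc 0" unfolding q_def by presburger
    then show ?case by (simp add: \<chi>_def)
  next
    case (ge2 m)
    have "e + 2 + Suc (Suc m) = e + 2 + m + 2" by simp
    then show ?case using \<chi>_step[of "e + 2 + m"] \<Phi>(1)[of "e + 2 + m"] ge2(1) by (simp only:)
  qed
  let ?Y = "\<lambda>a x. X a x - \<chi> a *s x" and ?\<Psi> = "\<lambda>a. \<Phi> a - \<chi> a"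
  have \<chi>: "\<chi> (a + b + 1) = 4 * \<chi> (a + b - 1)" if "a + b \<ge> 1" for a b
  proof -
    have "a + b - 1 + 2 = a + b + 1" using that by simp
    then show ?thesis using \<chi>_step[of "a + b - 1"] by (simp only:)
  qed
  interpret Y: word_module scale ?Y C K v0 ?\<Psi> N
    by (rule twisted_word_module[OF \<chi>])
  have above: "?\<Psi> a = 0" if "a > e + 1" for a
  proof -
    obtain m where "a = e + 2 + m" using \<open>a > e + 1\<close> le_Suc_ex[of "e + 2" a] by auto
    then show ?thesis using \<chi>_eq[of m] by simp
  qed
  \<comment> \<open>Otherwise \<open>\<Phi>\<close> would follow the geometric pattern at
    \<open>e + 1\<close> too, against nondegeneracy.\<close>
  have ne: "?\<Psi> (e + 1) \<noteq> 0"
  proof -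
    have "e + 1 + 2 = e + 3" by simp
    then have "\<chi> (e + 3) = 4 * \<chi> (e + 1)" using \<chi>_step[of "e + 1"] by (simp only:)
    moreover have "\<Phi> (e + 3) = \<chi> (e + 3)" using above[of "e + 3"] by simp
    ultimately show ?thesis using \<Phi>(2) by auto
  qed
  have SY: "?Y a y \<in> S" if "y \<in> S" for a y
    using that S by (intro subspace_diff subspace_scale)
  show ?thesis
  proof (cases "N \<ge> 2")
    case True
    interpret Z: generic_module scale ?Y C K v0 ?\<Psi> N e
      by unfold_locales (use True e above ne in auto)
    show ?thesis using Z.v0_in_submodule[OF S(1,2) SY x] .
  next
    case False
    then have "N = 1" "e = 0" using e by auto
    have "word_module scale ?Y C K v0 ?\<Psi> 1"
      using Y.word_module_axioms unfolding \<open>N = 1\<close> .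
    then interpret Z: rank_one_module scale ?Y C K v0 ?\<Psi>
      by (intro rank_one_module.intro filtered_word_module.intro
          filtered_word_module_axioms.intro rank_one_module_axioms.intro)
        (use \<open>e = 0\<close> above ne in auto)
    show ?thesis using Z.v0_in_submodule[OF S(1,2) SY x] .
  qed
qed

end

section \<open>The module of the free algebra modulo the Whittaker kernel\<close>

type_synonym 'k words = "nat list \<Rightarrow> 'k"

definition word :: "nat list \<Rightarrow> nat list \<Rightarrow> 'k::field" where
  "word u = (\<lambda>w. if w = u then 1 else 0)"

interpretation fa: vector_space "fa_smult :: 'k::field \<Rightarrow> 'k words \<Rightarrow> 'k words"
  by unfold_locales (auto simp: fa_smult_def fun_eq_iff algebra_simps)

lemma fa_arith: "fa_add f g = f + g" "fa_minus f g = f - g" "fa_zero = 0" "fa_one = word []"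
  by (auto simp: fa_add_def fa_minus_def fa_zero_def fa_one_def word_def fun_eq_iff)

lemma Ugen_word: "Ugen (int a - 1) = word [a]"
  by (simp add: Ugen_def word_def)

definition lmul :: "nat \<Rightarrow> 'k words \<Rightarrow> ('k::field) words" where
  "lmul a f = (\<lambda>w. case w of [] \<Rightarrow> 0 | b # v \<Rightarrow> if b = a then f v else 0)"

lemma lmul_simps [simp]: "lmul a f [] = 0" "lmul a f (b # v) = (if b = a then f v else 0)"
  by (simp_all add: lmul_def)

lemma lmul_linear: "lmul a (f + g) = lmul a f + lmul a g" "lmul a (f - g) = lmul a f - lmul a g"
  "lmul a (fa_smult c f) = fa_smult c (lmul a f)" "lmul a 0 = 0"
  by (auto simp: lmul_def fa_smult_def fun_eq_iff split: list.split)

lemma lmul_word: "lmul a (word w) = word (a # w)"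
  by (auto simp: lmul_def word_def fun_eq_iff split: list.split)

lemma fa_mul_linear_left:
  "fa_mul (f + g) h = fa_mul f h + fa_mul g h" "fa_mul (f - g) h = fa_mul f h - fa_mul g h"
  "fa_mul (fa_smult c f) h = fa_smult c (fa_mul f h)" "fa_mul 0 h = 0"
  by (auto simp: fa_mul_def fa_smult_def fun_eq_iff algebra_simps sum.distrib sum_subtractf sum_distrib_left)

lemma fa_mul_lmul: "fa_mul (lmul a f) h = lmul a (fa_mul f h)"
proof
  fix w show "fa_mul (lmul a f) h w = lmul a (fa_mul f h) w"
    by (cases w) (auto simp: fa_mul_def sum.atMost_Suc_shift simp del: sum.atMost_Suc)
qed

lemma fa_mul_word_Nil: "fa_mul (word []) h = h"
proof
  fix w :: "nat list"
  have "fa_mul (word []) h w = (\<Sum>i\<le>length w. if i = 0 then h w else 0)"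
    unfolding fa_mul_def by (rule sum.cong) (auto simp: word_def)
  then show "fa_mul (word []) h w = h w" by simp
qed

lemma fa_mul_word: "fa_mul (word u) h = foldr lmul u h"
  by (induction u) (simp_all add: fa_mul_word_Nil lmul_word[symmetric] fa_mul_lmul)

lemma fa_mul_Ugen: "fa_mul (Ugen (int a - 1)) h = lmul a h"
  by (simp add: Ugen_word fa_mul_word)

lemma subspace_fa: "fa.subspace (fa :: ('k::field) words set)"
proof (rule fa.subspaceI)
  fix f g :: "'k words" and c :: 'k
  show "0 \<in> (fa :: 'k words set)" by (simp add: fa_def)
  show "f + g \<in> fa" if "f \<in> fa" "g \<in> fa"
  proof -
    have "{w. (f + g) w \<noteq> 0} \<subseteq> {w. f w \<noteq> 0} \<union> {w. g w \<noteq> 0}" by auto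
    then show ?thesis using that unfolding fa_def by (auto intro: finite_subset)
  qed
  show "fa_smult c f \<in> fa" if "f \<in> fa"
  proof -
    have "{w. fa_smult c f w \<noteq> 0} \<subseteq> {w. f w \<noteq> 0}" by (auto simp: fa_smult_def)
    then show ?thesis using that unfolding fa_def by (auto intro: finite_subset)
  qed
qed

lemma support_lmul: "{w. lmul a f w \<noteq> 0} = (#) a ` {w. f w \<noteq> 0}"
proof -
  have "lmul a f w \<noteq> 0 \<longleftrightarrow> w \<in> (#) a ` {w. f w \<noteq> 0}" for w by (cases w) auto
  then show ?thesis by auto
qed

lemma lmul_in_fa: "f \<in> fa \<Longrightarrow> lmul a f \<in> fa"
  by (simp add: fa_def support_lmul)

lemma word_in_fa: "word u \<in> fa"
  by (simp add: fa_def word_def)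

lemma fa_cyclic:
  assumes S: "fa.subspace S" "word [] \<in> S" "\<And>a f. f \<in> S \<Longrightarrow> lmul a f \<in> S"
  shows "(fa :: ('k::field) words set) \<subseteq> S"
proof
  fix f :: "'k words" assume "f \<in> fa"
  have word: "word u \<in> S" for u
    by (induction u) (use S in \<open>auto simp: lmul_word[symmetric]\<close>)
  have "(\<lambda>w. if w \<in> A then f w else 0) \<in> S" if "finite A" for A
    using that
  proof (induction A)
    case empty
    then show ?case using fa.subspace_0[OF S(1)] by (simp add: zero_fun_def)
  next
    case (insert u A)
    have "(\<lambda>w. if w \<in> insert u A then f w else 0) = fa_smult (f u) (word u) + (\<lambda>w. if w \<in> A then f w else 0)"
      using insert(2) by (auto simp: fun_eq_iff fa_smult_def word_def)
    then show ?case using insert(3) by (simp add: fa.subspace_add[OF S(1)] fa.subspace_scale[OF S(1)] word)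
  qed
  from this[of "{w. f w \<noteq> 0}"] have "(\<lambda>w. if f w \<noteq> 0 then f w else 0) \<in> S"
    using \<open>f \<in> fa\<close> by (simp add: fa_def)
  moreover have "(\<lambda>w. if f w \<noteq> 0 then f w else 0) = f" by auto
  ultimately show "f \<in> S" by simp
qed

text \<open>Scalars are multiples of the empty word, and \<open>fa\<close> is generated from it by
  letters, so closure under \<open>fa_mul\<close> can be checked on scalars and letters.\<close>

lemma left_ideal_iff:
  "left_ideal L \<longleftrightarrow> L \<subseteq> fa \<and> fa.subspace L \<and> (\<forall>a. \<forall>f\<in>L. lmul a f \<in> L)" (is "_ \<longleftrightarrow> ?R")
proof
  assume L: "left_ideal L"
  have mul: "fa_mul f g \<in> L" if "f \<in> fa" "g \<in> L" for f g using that L by (simp add: left_ideal_def)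
  have "lmul a g \<in> L" if "g \<in> L" for a g
    using mul[OF word_in_fa that, of "[a]"] by (simp add: fa_mul_word)
  moreover have "fa_smult c g \<in> L" if "g \<in> L" for c g
    using mul[OF fa.subspace_scale[OF subspace_fa word_in_fa] that, of c "[]"]
    by (simp add: fa_mul_linear_left fa_mul_word)
  ultimately show ?R using L by (auto simp: left_ideal_def fa_arith intro: fa.subspaceI)
next
  assume R: ?R
  have "fa_mul f g \<in> L" if "g \<in> L" "f \<in> fa" for f g
  proof -
    have "fa \<subseteq> {f. fa_mul f g \<in> L}"
      by (rule fa_cyclic)
        (use R that in \<open>auto intro!: fa.subspaceI simp: fa_mul_linear_left fa_mul_word fa_mul_lmul
          fa.subspace_0 fa.subspace_add fa.subspace_scale\<close>)
    then show ?thesis using that by auto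
  qed
  then show "left_ideal L" using R by (auto simp: left_ideal_def fa_arith fa.subspace_0 fa.subspace_add)
qed

lemma fa_mul_Orel:
  "fa_mul (Orel (int a - 1) (int b - 1)) h = lmul a (lmul b h) - lmul b (lmul a h)
    - fa_smult (of_nat a - of_nat b) (lmul (a + b + 1) h - fa_smult 4 (lmul (a + b - 1) h))"
proof -
  \<comment> \<open>For \<open>a = b = 0\<close> the left side has \<open>Ugen (- 2) = 0\<close> and
    the right side the truncated letter \<open>0\<close>, but the scalar is zero.\<close>
  have "fa_smult (of_int (int a - int b)) (Ugen (int a + int b - 2)) = (fa_smult (of_nat a - of_nat b) (word [a + b - 1]) :: 'a words)"
  proof (cases "a + b = 0")
    case False
    then have "int a + int b - 2 = int (a + b - 1) - 1" by linarith
    then show ?thesis by (simp only: Ugen_word) simp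
  qed simp
  then have "fa_smult (of_int (int a - int b)) (Ugen (int a + int b) - fa_smult 4 (Ugen (int a + int b - 2)))
      = (fa_smult (of_nat a - of_nat b) (word [a + b + 1] - fa_smult 4 (word [a + b - 1])) :: 'a words)"
    using Ugen_word[of "a + b + 1", where 'a = 'a]
    by (simp only: fa.scale_right_diff_distrib fa.scale_left_commute[of _ 4]) simp
  moreover have "int a - 1 - (int b - 1) = int a - int b" "int a - 1 + (int b - 1) + 2 = int a + int b"
    "int a - 1 + (int b - 1) = int a + int b - 2" by simp_all
  ultimately have "Orel (int a - 1) (int b - 1) = (word [a, b] - word [b, a]
      - fa_smult (of_nat a - of_nat b) (word [a + b + 1] - fa_smult 4 (word [a + b - 1])) :: 'a words)"
    unfolding Orel_def fa_arith by (simp only: Ugen_word) (simp add: fa_mul_word lmul_word)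
  then show ?thesis by (simp add: fa_mul_linear_left fa_mul_word)
qed

text \<open>The closure conditions behind \<open>whittaker_kernel\<close> in terms of letters; the
  kernel is the least such set.\<close>

definition whittaker_ideal :: "(int \<Rightarrow> 'k::field) \<Rightarrow> nat \<Rightarrow> 'k words set \<Rightarrow> bool" where
  "whittaker_ideal phi n L \<longleftrightarrow> L \<subseteq> fa \<and> fa.subspace L \<and> (\<forall>a. \<forall>f\<in>L. lmul a f \<in> L) \<and>
    (\<forall>a b. \<forall>f\<in>fa. lmul a (lmul b f) - lmul b (lmul a f)
      - fa_smult (of_nat a - of_nat b) (lmul (a + b + 1) f - fa_smult 4 (lmul (a + b - 1) f)) \<in> L) \<and>
    (\<forall>a>n. word [a] - fa_smult (phi (int a - 1)) (word []) \<in> L)"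

lemma ex_nat_minus_1: "i \<ge> -1 \<Longrightarrow> \<exists>a. i = int a - 1"
  by (rule exI[of _ "nat (i + 1)"]) simp

lemma whittaker_kernel_eq: "whittaker_kernel phi n = \<Inter> {L. whittaker_ideal phi n L}"
proof -
  have "(left_ideal L \<and> (\<forall>i j. i \<ge> -1 \<longrightarrow> j \<ge> -1 \<longrightarrow> (\<forall>b\<in>fa. fa_mul (Orel i j) b \<in> L)) \<and>
      (\<forall>k. k \<ge> int n \<longrightarrow> fa_minus (Ugen k) (fa_smult (phi k) fa_one) \<in> L)) \<longleftrightarrow> whittaker_ideal phi n L" for L
  proof -
    have "(\<forall>i j. i \<ge> -1 \<longrightarrow> j \<ge> -1 \<longrightarrow> (\<forall>b\<in>fa. fa_mul (Orel i j) b \<in> L)) \<longleftrightarrow>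
        (\<forall>a b. \<forall>f\<in>fa. fa_mul (Orel (int a - 1) (int b - 1)) f \<in> L)"
    proof (intro iffI allI impI)
      fix i j :: int assume "\<forall>a b. \<forall>f\<in>fa. fa_mul (Orel (int a - 1) (int b - 1)) f \<in> L" "i \<ge> -1" "j \<ge> -1"
      then show "\<forall>b\<in>fa. fa_mul (Orel i j) b \<in> L" using ex_nat_minus_1 by metis
    qed auto
    moreover have "(\<forall>k. k \<ge> int n \<longrightarrow> fa_minus (Ugen k) (fa_smult (phi k) fa_one) \<in> L) \<longleftrightarrow>
        (\<forall>a>n. word [a] - fa_smult (phi (int a - 1)) (word []) \<in> L)"
    proof (intro iffI allI impI)
      fix k assume *: "\<forall>a>n. word [a] - fa_smult (phi (int a - 1)) (word []) \<in> L" "k \<ge> int n"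
      then obtain a where "k = int a - 1" using ex_nat_minus_1[of k] by auto
      then show "fa_minus (Ugen k) (fa_smult (phi k) fa_one) \<in> L" using * by (simp add: Ugen_word fa_arith)
    next
      fix a assume *: "\<forall>k. k \<ge> int n \<longrightarrow> fa_minus (Ugen k) (fa_smult (phi k) fa_one) \<in> L" "a > n"
      then have "int a - 1 \<ge> int n" by simp
      with *(1) show "word [a] - fa_smult (phi (int a - 1)) (word []) \<in> L" 
        by (simp only: Ugen_word[symmetric] fa_arith[symmetric])
    qed
    ultimately show ?thesis by (simp only: left_ideal_iff whittaker_ideal_def fa_mul_Orel conj_assoc)
  qed
  then show ?thesis unfolding whittaker_kernel_def by simp
qed

lemma whittaker_ideal_fa: "whittaker_ideal phi n fa"
  unfolding whittaker_ideal_def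
  by (auto intro!: subspace_fa lmul_in_fa word_in_fa fa.subspace_diff[OF subspace_fa] fa.subspace_scale[OF subspace_fa])

lemma whittaker_ideal_kernel: "whittaker_ideal phi n (whittaker_kernel phi n)"
proof -
  let ?M = "{L. whittaker_ideal phi n L}"
  have 1: "\<And>L. L \<in> ?M \<Longrightarrow> fa.subspace L" by (simp add: whittaker_ideal_def)
  show ?thesis unfolding whittaker_kernel_eq
  proof (subst whittaker_ideal_def, intro conjI)
    show "\<Inter> ?M \<subseteq> fa" using whittaker_ideal_fa by auto
    show "fa.subspace (\<Inter> ?M)" using 1 by (intro fa.subspace_Inter) auto
  qed (auto simp: whittaker_ideal_def)
qed

lemma whittaker_kernel_minimal: "whittaker_ideal phi n L \<Longrightarrow> whittaker_kernel phi n \<subseteq> L"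
  by (auto simp: whittaker_kernel_eq)

section \<open>Functionals on the free algebra and the left ideals they annihilate\<close>

definition ev :: "(nat list \<Rightarrow> 'k) \<Rightarrow> 'k words \<Rightarrow> 'k::field" where
  "ev M f = (\<Sum>w | f w \<noteq> 0. f w * M w)"

lemma ev_superset: "finite A \<Longrightarrow> {w. f w \<noteq> 0} \<subseteq> A \<Longrightarrow> ev M f = (\<Sum>w\<in>A. f w * M w)"
  unfolding ev_def by (rule sum.mono_neutral_left) auto

lemma ev_linear:
  assumes "f \<in> fa" "g \<in> fa"
  shows "ev M (f + g) = ev M f + ev M g" "ev M (f - g) = ev M f - ev M g"
proof -
  let ?A = "{w. f w \<noteq> 0} \<union> {w. g w \<noteq> 0}"
  have A: "finite ?A" using assms by (simp add: fa_def)
  have f: "ev M f = (\<Sum>w\<in>?A. f w * M w)" and g: "ev M g = (\<Sum>w\<in>?A. g w * M w)"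
    by (rule ev_superset[OF A], auto)+
  have "ev M (f + g) = (\<Sum>w\<in>?A. (f + g) w * M w)" by (rule ev_superset[OF A]) auto
  then show "ev M (f + g) = ev M f + ev M g" by (simp only: f g plus_fun_apply distrib_right sum.distrib)
  have "ev M (f - g) = (\<Sum>w\<in>?A. (f - g) w * M w)" by (rule ev_superset[OF A]) auto
  then show "ev M (f - g) = ev M f - ev M g" by (simp only: f g minus_apply left_diff_distrib sum_subtractf)
qed

lemma ev_scale: "ev M (fa_smult c f) = c * ev M f"
proof (cases "c = 0")
  case True
  then show ?thesis by (simp add: ev_def fa_smult_def)
next
  case False
  then show ?thesis by (simp add: ev_def fa_smult_def sum_distrib_left mult.assoc)
qed

lemma ev_0: "ev M 0 = 0"
  by (simp add: ev_def)

lemma ev_word: "ev M (word u) = M u"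
  using ev_superset[of "{u}" "word u" M] by (simp add: word_def)

lemma ev_lmul: "ev M (lmul a f) = ev (\<lambda>w. M (a # w)) f"
  unfolding ev_def support_lmul by (subst sum.reindex) auto

text \<open>The largest left ideal on which the linear extension of \<open>M\<close> vanishes; the
  prefix \<open>u\<close> provides stability under left multiplication.\<close>

definition annihilated :: "(nat list \<Rightarrow> 'k) \<Rightarrow> ('k::field) words set" where
  "annihilated M = {f \<in> fa. \<forall>u. ev (\<lambda>w. M (u @ w)) f = 0}"

context straightening
begin

text \<open>\<open>L_swap\<close> behind every prefix yields the bracket relations, and
  \<open>L_snoc\<close> the relations on the generator. A value of \<open>N\<close> below
  \<open>Suc n\<close> allows for an extended character.\<close>

lemma whittaker_ideal_annihilated:
  assumes "N \<le> Suc n" "\<And>a. a > n \<Longrightarrow> \<Phi> a = phi (int a - 1)"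
  shows "whittaker_ideal phi n (annihilated L)"
  unfolding whittaker_ideal_def
proof (intro conjI allI ballI impI)
  note closed = lmul_in_fa word_in_fa fa.subspace_diff[OF subspace_fa] fa.subspace_scale[OF subspace_fa]
    fa.subspace_add[OF subspace_fa]
  show "annihilated L \<subseteq> fa" by (auto simp: annihilated_def)
  show "fa.subspace (annihilated L)"
    by (rule fa.subspaceI) (auto simp: annihilated_def fa.subspace_0[OF subspace_fa] closed ev_linear ev_scale ev_0)
  show "lmul a f \<in> annihilated L" if "f \<in> annihilated L" for a f
  proof -
    have "ev (\<lambda>w. L (u @ w)) (lmul a f) = 0" for u
    proof -
      have "ev (\<lambda>w. L ((u @ [a]) @ w)) f = 0" using that unfolding annihilated_def by blast
      then show ?thesis by (simp add: ev_lmul)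
    qed
    then show ?thesis using that by (simp add: annihilated_def lmul_in_fa)
  qed
  show "lmul a (lmul b f) - lmul b (lmul a f)
      - fa_smult (of_nat a - of_nat b) (lmul (a + b + 1) f - fa_smult 4 (lmul (a + b - 1) f)) \<in> annihilated L"
    (is "?r \<in> _") if f: "f \<in> fa" for a b f
  proof -
    have "ev (\<lambda>w. L (u @ w)) ?r = 0" for u
    proof -
      have "ev (\<lambda>w. L (u @ w)) ?r = ev (\<lambda>w. L (u @ a # b # w)) f - ev (\<lambda>w. L (u @ b # a # w)) f
          - (of_nat a - of_nat b) * (ev (\<lambda>w. L (u @ (a + b + 1) # w)) f - 4 * ev (\<lambda>w. L (u @ (a + b - 1) # w)) f)"
        by (simp add: ev_linear ev_scale closed f ev_lmul)
      also have "\<dots> = (\<Sum>w | f w \<noteq> 0. f w * (L (u @ a # b # w) - L (u @ b # a # w) - br u a b w))"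
        by (simp add: ev_def br_def sum_subtractf sum_distrib_left right_diff_distrib mult.left_commute)
      also have "\<dots> = 0"
      proof -
        have "L (u @ a # b # w) - L (u @ b # a # w) - br u a b w = 0" for w
          using L_swap[of u a b w] by (simp only: diff_diff_eq right_minus_eq)
        then show ?thesis by (simp only: mult_zero_right sum.neutral_const)
      qed
      finally show ?thesis .
    qed
    then show ?thesis by (simp add: annihilated_def f closed)
  qed
  show "word [a] - fa_smult (phi (int a - 1)) (word []) \<in> annihilated L" if "a > n" for a
  proof -
    have "ev (\<lambda>w. L (u @ w)) (word [a] - fa_smult (phi (int a - 1)) (word [])) = 0" for u
      using L_snoc[of a u] assms that by (simp add: ev_linear ev_scale closed ev_word)
    then show ?thesis by (simp add: annihilated_def closed)
  qed
qed

lemma ev_annihilated: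
  assumes "f \<in> annihilated L" shows "ev L f = 0"
proof -
  have "ev (\<lambda>w. L ([] @ w)) f = 0" using assms unfolding annihilated_def by blast
  then show ?thesis by simp
qed

end

section \<open>Submodules of the quotient as stable subspaces of the free algebra\<close>

lemma Wcoset_eq_iff:
  assumes "x \<in> fa" "y \<in> fa"
  shows "Wcoset phi n x = Wcoset phi n y \<longleftrightarrow> x - y \<in> whittaker_kernel phi n"
proof -
  let ?K = "whittaker_kernel phi n"
  have K: "fa.subspace ?K" using whittaker_ideal_kernel[of phi n] by (simp add: whittaker_ideal_def)
  show ?thesis
  proof
    assume "Wcoset phi n x = Wcoset phi n y"
    moreover have "y \<in> Wcoset phi n y" using assms fa.subspace_0[OF K] by (simp add: Wcoset_def fa_arith)
    ultimately have "y \<in> Wcoset phi n x" by (simp only:)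
    then show "x - y \<in> ?K" by (simp add: Wcoset_def fa_arith)
  next
    assume xy: "x - y \<in> ?K"
    have "x - z \<in> ?K \<longleftrightarrow> y - z \<in> ?K" for z
      using fa.subspace_add[OF K xy, of "y - z"] fa.subspace_diff[OF K _ xy, of "x - z"] by auto
    then show "Wcoset phi n x = Wcoset phi n y" by (simp add: Wcoset_def fa_arith)
  qed
qed

text \<open>A submodule is the image of a stable subspace \<open>S\<close> containing the kernel,
  and \<open>S\<close> is all of \<open>fa\<close> once it contains the generator.\<close>

lemma W_irreducibleI:
  assumes one: "word [] \<notin> whittaker_kernel phi n"
    and S: "\<And>S x. fa.subspace S \<Longrightarrow> whittaker_kernel phi n \<subseteq> S \<Longrightarrow> (\<And>a f. f \<in> S \<Longrightarrow> lmul a f \<in> S) \<Longrightarrow>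
      x \<in> S \<Longrightarrow> x \<in> fa \<Longrightarrow> x \<notin> whittaker_kernel phi n \<Longrightarrow> word [] \<in> S"
  shows "W_irreducible phi n"
  unfolding W_irreducible_def
proof (intro conjI allI impI)
  let ?K = "whittaker_kernel phi n"
  have K: "?K \<subseteq> fa" using whittaker_ideal_kernel[of phi n] by (simp add: whittaker_ideal_def)
  note zero = fa.subspace_0[OF subspace_fa]
  have "Wcoset phi n (word []) \<noteq> Wcoset phi n 0"
    using one by (simp add: Wcoset_eq_iff word_in_fa zero)
  then show "Wmodule phi n \<noteq> {Wcoset phi n fa_zero}"
    using word_in_fa[of "[]"] unfolding Wmodule_def fa_arith by blast
  fix N assume N: "W_submodule phi n N"
  define S where "S = {x \<in> fa. Wcoset phi n x \<in> N}"
  have N_eq: "N = Wcoset phi n ` S" using N by (auto simp: W_submodule_def Wmodule_def S_def)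
  have lm: "lmul a f \<in> S" if "f \<in> S" for a f
  proof -
    have "int a - 1 \<ge> -1" by simp
    then have "Wcoset phi n (fa_mul (Ugen (int a - 1)) f) \<in> N"
      using N that unfolding W_submodule_def S_def by blast
    then show ?thesis using that by (simp add: fa_mul_Ugen S_def lmul_in_fa)
  qed
  have sub: "fa.subspace S"
    using N by (intro fa.subspaceI) (auto simp: S_def W_submodule_def fa_arith zero
        fa.subspace_add[OF subspace_fa] fa.subspace_scale[OF subspace_fa])
  have KS: "?K \<subseteq> S"
  proof
    fix x assume x: "x \<in> ?K"
    then have "Wcoset phi n x = Wcoset phi n 0" using K by (subst Wcoset_eq_iff) (auto simp: zero)
    then show "x \<in> S" using N x K by (auto simp: S_def W_submodule_def fa_arith)
  qed
  show "N = {Wcoset phi n fa_zero} \<or> N = Wmodule phi n"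
  proof (cases "S \<subseteq> ?K")
    case True
    then have "Wcoset phi n x = Wcoset phi n 0" if "x \<in> S" for x
      using that by (subst Wcoset_eq_iff) (auto simp: zero S_def)
    then have "Wcoset phi n ` S = (\<lambda>_. Wcoset phi n 0) ` S" by (rule image_cong[OF refl])
    then have "N = {Wcoset phi n 0}" using fa.subspace_0[OF sub] unfolding N_eq by (metis empty_iff image_constant_conv)
    then show ?thesis by (simp add: fa_arith)
  next
    case False
    then obtain x where "x \<in> S" "x \<notin> ?K" by blast
    moreover have "S \<subseteq> fa" by (simp add: S_def)
    ultimately have "word [] \<in> S" using S[OF sub KS lm] by blast
    then have "fa \<subseteq> S" by (rule fa_cyclic[OF sub _ lm])
    then have "S = fa" using \<open>S \<subseteq> fa\<close> by (rule equalityI[rotated])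
    then show ?thesis unfolding N_eq Wmodule_def by simp
  qed
qed

lemma not_W_irreducibleI:
  assumes J: "J \<subseteq> fa" "fa.subspace J" "\<And>a f. f \<in> J \<Longrightarrow> lmul a f \<in> J"
    and KJ: "whittaker_kernel phi n \<subseteq> J" "word [] \<notin> J" and x: "x \<in> J" "x \<notin> whittaker_kernel phi n"
  shows "\<not> W_irreducible phi n"
proof
  assume irr: "W_irreducible phi n"
  let ?N = "Wcoset phi n ` J"
  note zero = fa.subspace_0[OF subspace_fa]
  have mem: "Wcoset phi n y \<in> ?N \<longleftrightarrow> y \<in> J" if y: "y \<in> fa" for y
  proof
    assume "Wcoset phi n y \<in> ?N"
    then obtain z where z: "z \<in> J" "y - z \<in> whittaker_kernel phi n" using Wcoset_eq_iff y J(1) by blast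
    then have "(y - z) + z \<in> J" using KJ by (intro fa.subspace_add[OF J(2)]) auto
    then show "y \<in> J" by simp
  qed simp
  have "W_submodule phi n ?N"
    unfolding W_submodule_def fa_arith
  proof (intro conjI ballI allI impI)
    show "?N \<subseteq> Wmodule phi n" using J(1) by (auto simp: Wmodule_def)
    show "Wcoset phi n 0 \<in> ?N" using fa.subspace_0[OF J(2)] by simp
    fix y z :: "'a words" and c :: 'a and k :: int assume y: "y \<in> fa" "Wcoset phi n y \<in> ?N"
    then have yJ: "y \<in> J" by (simp add: mem)
    show "Wcoset phi n (y + z) \<in> ?N" if "z \<in> fa" "Wcoset phi n z \<in> ?N"
      using that yJ by (simp add: mem fa.subspace_add[OF J(2)])
    show "Wcoset phi n (fa_smult c y) \<in> ?N" using yJ by (simp add: fa.subspace_scale[OF J(2)])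
    show "Wcoset phi n (fa_mul (Ugen k) y) \<in> ?N" if "-1 \<le> k"
      using ex_nat_minus_1[OF that] yJ J(3) by (auto simp: fa_mul_Ugen)
  qed
  then consider "?N = {Wcoset phi n 0}" | "?N = Wmodule phi n"
    using irr unfolding W_irreducible_def fa_arith by blast
  then show False
  proof cases
    case 1
    then have "Wcoset phi n x = Wcoset phi n 0" using x(1) by blast
    then show ?thesis using x J(1) by (subst (asm) Wcoset_eq_iff) (auto simp: zero)
  next
    case 2
    have "Wcoset phi n (word []) \<in> ?N" unfolding 2 Wmodule_def by (rule imageI[OF word_in_fa])
    then have "word [] \<in> J" by (simp only: mem[OF word_in_fa])
    then show ?thesis using KJ by simp
  qed
qed

lemma word_module_fa:
  fixes phi :: "int \<Rightarrow> 'k::field_char_0"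
  shows "word_module fa_smult lmul fa (whittaker_kernel phi n) (word []) (\<lambda>a. phi (int a - 1)) (Suc n)"
proof -
  let ?K = "whittaker_kernel phi n"
  have K: "whittaker_ideal phi n ?K" by (rule whittaker_ideal_kernel)
  show ?thesis
  proof
    fix a b and c :: 'k and f g :: "'k words" and S :: "'k words set"
    show "lmul a (f + g) = lmul a f + lmul a g" "lmul a (fa_smult c f) = fa_smult c (lmul a f)"
      by (rule lmul_linear)+
    show "fa.subspace (fa :: 'k words set)" "word [] \<in> (fa :: 'k words set)" by (rule subspace_fa word_in_fa)+
    show "fa.subspace ?K" using K by (simp add: whittaker_ideal_def)
    show "f \<in> fa \<Longrightarrow> lmul a f \<in> fa" by (rule lmul_in_fa)
    show "f \<in> ?K \<Longrightarrow> lmul a f \<in> ?K" using K by (simp add: whittaker_ideal_def)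
    show "f \<in> fa \<Longrightarrow> lmul a (lmul b f) - lmul b (lmul a f)
      - fa_smult (of_nat a - of_nat b) (lmul (a + b + 1) f - fa_smult 4 (lmul (a + b - 1) f)) \<in> ?K"
      using K unfolding whittaker_ideal_def by (elim conjE) (drule spec, drule spec, drule bspec, assumption+)
    show "fa.subspace S \<Longrightarrow> word [] \<in> S \<Longrightarrow> (\<And>a x. x \<in> S \<Longrightarrow> lmul a x \<in> S) \<Longrightarrow> fa \<subseteq> S"
      by (rule fa_cyclic)
    show "a \<ge> Suc n \<Longrightarrow> lmul a (word []) - fa_smult (phi (int a - 1)) (word []) \<in> ?K"
      using K by (simp add: whittaker_ideal_def lmul_word)
  qed
qed

section \<open>The irreducibility criterion for universal Whittaker modules\<close>

theorem theorem6p6: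
  fixes phi :: "int \<Rightarrow> 'k::field_char_0" and n :: nat
  assumes "lie_hom_Fn n phi"
  shows "(n = 0 \<longrightarrow> (W_irreducible phi n \<longleftrightarrow> phi 2 \<noteq> 4 * phi 0)) \<and>
         (n \<ge> 1 \<longrightarrow> (W_irreducible phi n \<longleftrightarrow>
             phi (2 * int n + 1) \<noteq> 4 * phi (2 * int n - 1) \<or> phi (2 * int n + 2) \<noteq> 4 * phi (2 * int n)))"
proof -
  define \<Phi> where "\<Phi> = (\<lambda>a. phi (int a - 1))"
  define K where "K = whittaker_kernel phi n"
  have hom: "(of_nat a - of_nat b) * (\<Phi> (a + b + 1) - 4 * \<Phi> (a + b - 1)) = 0" if "a \<ge> Suc n" "b \<ge> Suc n" for a b
  proof -
    have "of_int ((int a - 1) - (int b - 1)) * (phi ((int a - 1) + (int b - 1) + 2) - 4 * phi ((int a - 1) + (int b - 1))) = 0"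
      using that by (intro assms[unfolded lie_hom_Fn_def, rule_format]) simp_all
    moreover have "int (a + b + 1) - 1 = (int a - 1) + (int b - 1) + 2" "int (a + b - 1) - 1 = (int a - 1) + (int b - 1)"
      using that by simp_all
    ultimately show ?thesis by (simp add: \<Phi>_def)
  qed
  have step: "\<Phi> (a + 2) = 4 * \<Phi> a" if "a \<ge> 2 * n + 2" for a
  proof -
    \<comment> \<open>\<open>a - n\<close> and \<open>n + 1\<close> are distinct letters of the
      subalgebra with sum \<open>a + 1\<close>, so their bracket involves exactly the letters
      \<open>a + 2\<close> and \<open>a\<close>.\<close>
    have "a - n \<noteq> Suc n \<Longrightarrow> of_nat (a - n) - of_nat (Suc n) \<noteq> (0::'k)" by (simp only: right_minus_eq of_nat_eq_iff not_False_eq_True)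
    then show ?thesis using hom[of "a - n" "Suc n"] that by simp
  qed
  have one: "word [] \<notin> K"
  proof
    assume "word [] \<in> K"
    \<comment> \<open>A functional with value 1 on the empty word shows that the generator is
      nonzero.\<close>
    interpret straightening "Suc n" \<Phi> "\<lambda>_. 1" by unfold_locales (rule hom)
    have "whittaker_ideal phi n (annihilated L)" by (rule whittaker_ideal_annihilated) (auto simp: \<Phi>_def)
    then have "word [] \<in> annihilated L" using \<open>word [] \<in> K\<close> whittaker_kernel_minimal K_def by blast
    from ev_annihilated[OF this] show False by (simp add: ev_word L_sorted base_def)
  qed
  interpret word_module fa_smult lmul fa K "word []" \<Phi> "Suc n"
    unfolding K_def \<Phi>_def by (rule word_module_fa)
  have irreducible: "W_irreducible phi n"
    if "Suc n \<ge> 2 \<and> e + 3 \<ge> 2 * Suc n \<or> Suc n = 1 \<and> e = 0"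
      "\<And>a. a \<ge> e + 2 \<Longrightarrow> \<Phi> (a + 2) = 4 * \<Phi> a" "\<Phi> (e + 3) \<noteq> 4 * \<Phi> (e + 1)" for e
    using one v0_in_submodule_of_nondegenerate[OF that] unfolding K_def by (rule W_irreducibleI)
  \<comment> \<open>\<open>c\<close> is the value of the extended character at the letter
    \<open>n\<close>. The index \<open>a + n - 1\<close> drops below \<open>Suc n\<close> only for
    \<open>n = 0\<close> and \<open>a = 1\<close>, where it is the letter \<open>n\<close>
    itself.\<close>
  have reducible: "\<not> W_irreducible phi n"
    if ext: "\<And>a. a \<ge> Suc n \<Longrightarrow> \<Phi> (a + n + 1) = 4 * (if a + n - 1 \<ge> Suc n then \<Phi> (a + n - 1) else c)" for c
  proof -
    define \<Phi>' where "\<Phi>' = (\<lambda>a. if a \<ge> Suc n then \<Phi> a else c)"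
    have ext': "\<Phi>' (a + n + 1) = 4 * \<Phi>' (a + n - 1)" if "a \<ge> Suc n" for a
      using ext[OF that] that unfolding \<Phi>'_def by simp
    have hom': "(of_nat a - of_nat b) * (\<Phi>' (a + b + 1) - 4 * \<Phi>' (a + b - 1)) = 0" if ab: "a \<ge> n" "b \<ge> n" for a b
    proof -
      consider "a = b" | "a \<ge> Suc n" "b \<ge> Suc n" | "a \<ge> Suc n" "b = n" | "a = n" "b \<ge> Suc n"
        using ab by (metis le_antisym not_less_eq_eq)
      then show ?thesis
      proof cases
        case 2
        then have "a + b - 1 \<ge> Suc n" "a + b + 1 \<ge> Suc n" by linarith+
        then show ?thesis using hom[OF 2] unfolding \<Phi>'_def by (simp only: if_True)
      next
        case 3
        then show ?thesis using ext'[of a] by (simp only:) simp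
      next
        case 4
        then show ?thesis using ext'[of b] by (simp only: add.commute[of n]) simp
      qed simp
    qed
    \<comment> \<open>\<open>E.L\<close> belongs to the module induced from the extension and
      annihilates \<open>word [n]\<close> minus \<open>c\<close> times the generator;
      \<open>U.L\<close> is 1 on \<open>[n]\<close> and 0 on the empty word, so this vector is
      nonzero in the universal module.\<close>
    interpret E: straightening n \<Phi>' "\<lambda>_. 1" by unfold_locales (rule hom')
    interpret U: straightening "Suc n" \<Phi> "\<lambda>w. if w = [n] then 1 else 0" by unfold_locales (rule hom)
    have E: "whittaker_ideal phi n (annihilated E.L)"
      by (rule E.whittaker_ideal_annihilated) (auto simp: \<Phi>'_def \<Phi>_def)
    have U: "whittaker_ideal phi n (annihilated U.L)"
      by (rule U.whittaker_ideal_annihilated) (auto simp: \<Phi>_def)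
    let ?x = "word [n] - fa_smult c (word []) :: 'k words"
    have x: "?x \<in> annihilated E.L"
    proof -
      have "E.L (u @ [n]) = c * E.L u" for u using E.L_snoc[of n u] by (simp add: \<Phi>'_def)
      then show ?thesis
        by (simp add: annihilated_def ev_linear ev_scale ev_word word_in_fa fa.subspace_diff[OF subspace_fa] fa.subspace_scale[OF subspace_fa])
    qed
    show ?thesis
    proof (rule not_W_irreducibleI)
      show "word [] \<notin> annihilated E.L"
        using E.ev_annihilated[of "word []"] by (auto simp: ev_word E.L_sorted E.base_def)
      show "?x \<notin> whittaker_kernel phi n"
      proof
        assume "?x \<in> whittaker_kernel phi n"
        then have "?x \<in> annihilated U.L" using whittaker_kernel_minimal[OF U] by blast
        from U.ev_annihilated[OF this] show False
          by (simp add: ev_linear ev_scale ev_word word_in_fa fa.subspace_scale[OF subspace_fa] U.L_sorted U.base_def)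
      qed
    qed (use E x whittaker_kernel_minimal[OF E] in \<open>auto simp: whittaker_ideal_def\<close>)
  qed
  show ?thesis
  proof (intro conjI impI)
    assume n: "n = 0"
    show "W_irreducible phi n \<longleftrightarrow> phi 2 \<noteq> 4 * phi 0"
    proof
      assume "phi 2 \<noteq> 4 * phi 0"
      then show "W_irreducible phi n"
        by (intro irreducible[of 0]) (use n step in \<open>auto simp: \<Phi>_def\<close>)
    next
      assume irr: "W_irreducible phi n"
      show "phi 2 \<noteq> 4 * phi 0"
      proof
        assume 0: "phi 2 = 4 * phi 0"
        \<comment> \<open>The bracket of the letters \<open>1\<close> and \<open>0\<close> forces
          \<open>\<Phi> 2 = 4 * c\<close>.\<close>
        have "\<not> W_irreducible phi n"
        proof (rule reducible[of "\<Phi> 2 / 4"])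
          fix a assume "a \<ge> Suc n"
          then consider "a = 1" | "a = 2" | "a \<ge> 3" by linarith
          then show "\<Phi> (a + n + 1) = 4 * (if a + n - 1 \<ge> Suc n then \<Phi> (a + n - 1) else \<Phi> 2 / 4)"
          proof cases
            case 3
            then have "a + n + 1 = (a - 1) + 2" "a + n - 1 = a - 1" "a - 1 \<ge> 2 * n + 2" "a - 1 \<ge> Suc n"
              using n by simp_all
            then show ?thesis using step[of "a - 1"] by (simp only: if_True)
          qed (use n 0 in \<open>auto simp: \<Phi>_def numeral_2_eq_2\<close>)
        qed
        then show False using irr by simp
      qed
    qed
  next
    assume n: "n \<ge> 1"
    define P Q where "P \<longleftrightarrow> \<Phi> (2 * n + 2) = 4 * \<Phi> (2 * n)" and "Q \<longleftrightarrow> \<Phi> (2 * n + 3) = 4 * \<Phi> (2 * n + 1)"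
    have idx: "int (2 * n + 2) - 1 = 2 * int n + 1" "int (2 * n) - 1 = 2 * int n - 1"
      "int (2 * n + 3) - 1 = 2 * int n + 2" "int (2 * n + 1) - 1 = 2 * int n" by simp_all
    have PQ: "phi (2 * int n + 1) \<noteq> 4 * phi (2 * int n - 1) \<or> phi (2 * int n + 2) \<noteq> 4 * phi (2 * int n) \<longleftrightarrow> \<not> P \<or> \<not> Q"
      unfolding P_def Q_def \<Phi>_def idx ..
    \<comment> \<open>The maximal index with a nonzero defect is \<open>e = 2 * n\<close> if
      \<open>Q\<close> fails, and \<open>e = 2 * n - 1\<close> if only \<open>P\<close>
      fails.\<close>
    have "W_irreducible phi n" if "\<not> Q"
      by (rule irreducible[of "2 * n"]) (use n step that in \<open>auto simp: Q_def\<close>)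
    moreover have "W_irreducible phi n" if "\<not> P" Q
    proof (rule irreducible[of "2 * n - 1"])
      show "\<Phi> (2 * n - 1 + 3) \<noteq> 4 * \<Phi> (2 * n - 1 + 1)"
      proof -
        have "2 * n - 1 + 3 = 2 * n + 2" "2 * n - 1 + 1 = 2 * n" using n by simp_all
        then show ?thesis using that(1) unfolding P_def by (simp only:) simp
      qed
      fix a assume "a \<ge> 2 * n - 1 + 2"
      then consider "a = 2 * n + 1" | "a \<ge> 2 * n + 2" by linarith
      then show "\<Phi> (a + 2) = 4 * \<Phi> a"
        by cases (use that(2) step in \<open>auto simp: Q_def numeral_3_eq_3\<close>)
    qed (use n in auto)
    \<comment> \<open>For \<open>n \<ge> 1\<close> the brackets of the letter \<open>n\<close> with
      larger letters involve only letters above \<open>n\<close>, so any \<open>c\<close> gives an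
      extension; 0 is taken.\<close>
    moreover have "\<not> W_irreducible phi n" if P Q
    proof (rule reducible[of 0])
      fix a assume a: "a \<ge> Suc n"
      have "\<Phi> (a + n + 1) = 4 * \<Phi> (a + n - 1)"
      proof -
        define b where "b = a + n - 1"
        consider "b = 2 * n" | "b = 2 * n + 1" | "b \<ge> 2 * n + 2" using a unfolding b_def by linarith
        then have "\<Phi> (b + 2) = 4 * \<Phi> b"
        proof cases
          case 2
          then have "b + 2 = 2 * n + 3" by simp
          then show ?thesis using \<open>Q\<close> 2 unfolding Q_def by (simp only:)
        qed (use \<open>P\<close> step in \<open>auto simp: P_def\<close>)
        moreover have "a + n + 1 = b + 2" using n by (simp add: b_def)
        ultimately show ?thesis unfolding b_def by (simp only:)
      qed
      moreover have "a + n - 1 \<ge> Suc n" using a n by linarith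
      ultimately show "\<Phi> (a + n + 1) = 4 * (if a + n - 1 \<ge> Suc n then \<Phi> (a + n - 1) else 0)"
        by (simp only: if_True)
    qed
    ultimately show "W_irreducible phi n \<longleftrightarrow>
        phi (2 * int n + 1) \<noteq> 4 * phi (2 * int n - 1) \<or> phi (2 * int n + 2) \<noteq> 4 * phi (2 * int n)"
      unfolding PQ by blast
  qed
qed

end
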